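(* Let $d\ge 1$ and $n\ge d+1$ be integers. Let $x_1,\dots,x_n\in\mathbb{R}^d$ be vectors such that the matrix $X=(x_1\,|\,\dots\,|\,x_n)\in\mathbb{R}^{d\times n}$ is regular. Then $$|\mathcal M(X)| = 2\sum_{q\ge 0} B(n,d-1-2q).$$ In particular, $|\mathcal M(X)|$ is the same for all $X\in\mathbb{R}^{d\times n}\setminus\mathcal D$.
   Context: Write $[n]=\{1,\dots,n\}$. For $X=(x_1|\dots|x_n)\in\mathbb{R}^{d\times n}$ with columns $x_i\in\mathbb{R}^d$, put $s_k(X)=x_1+\dots+x_k$ for $1\le k\le n$ and $H(X)=\operatorname{Conv}(s_1(X),\dots,s_n(X))\subseteq\mathbb{R}^d$. The group $\mathfrak B_n$ of signed permutations consists of pairs $g=(\sigma,\varepsilon)$ with $\sigma$ a permutation of $[n]$ and $\varepsilon\in\{\pm1\}^n$ (so it has $2^n n!$ elements); it acts on $\mathbb{R}^{d\times n}$ by $gX=(\varepsilon_1x_{\sigma(1)}|\dots|\varepsilon_nx_{\sigma(n)})$. Define $\mathcal M(X)=\{g\in\mathfrak B_n: 0\notin H(gX)\}$. For $g\in\mathfrak B_n$ and a $d$-element set $I\subseteq[n]$, let $D_{g,I}$ be the set of $X\in\mathbb{R}^{d\times n}$ such that the vectors $s_i(gX)$, $i\in I$, are linearly dependent. Let $\mathcal D=\bigcup_{g\in\mathfrak B_n}\bigcup_{|I|=d}D_{g,I}$. A configuration $X$ is called regular if $X\notin\mathcal D$. The $B$-Stirling numbers of the first kind $B(n,k)$, $n\ge1$,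 $k\in\mathbb{Z}$, are defined by $(t+1)(t+3)\cdots(t+2n-1)=\sum_{k\in\mathbb{Z}}B(n,k)t^k$; in particular $B(n,k)=0$ for $k\notin\{0,\dots,n\}$. *)

theory Defs
  imports "HOL-Analysis.Analysis" "HOL-Computational_Algebra.Polynomial"
    "HOL-Combinatorics.Permutations"
begin

text \<open>
  A matrix with \<open>d\<close> rows and \<open>n\<close> columns is given by its columns, as a function
  \<open>X :: nat \<Rightarrow> real ^ 'd\<close> with \<open>CARD('d) = d\<close>, of which only the values on \<open>{1..n}\<close>
  are ever used.
\<close>

definition psum :: "nat \<Rightarrow> (nat \<Rightarrow> real ^ 'd) \<Rightarrow> real ^ 'd" where
  "psum k X = (\<Sum>i = 1..k. X i)"

definition walk_hull :: "nat \<Rightarrow> (nat \<Rightarrow> real ^ 'd) \<Rightarrow> (real ^ 'd) set" where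
  "walk_hull n X = convex hull ((\<lambda>k. psum k X) ` {1..n})"

type_synonym signed_perm = "(nat \<Rightarrow> nat) \<times> (nat \<Rightarrow> real)"

text \<open>
  Both components are normalised outside \<open>{1..n}\<close> (identity, respectively \<open>undefined\<close>),
  so that distinct pairs are distinct signed permutations and cardinalities are meaningful.
\<close>

definition signed_perms :: "nat \<Rightarrow> signed_perm set" where
  "signed_perms n = {\<sigma>. \<sigma> permutes {1..n}} \<times> ({1..n} \<rightarrow>\<^sub>E {-1, 1})"

definition act :: "signed_perm \<Rightarrow> (nat \<Rightarrow> real ^ 'd) \<Rightarrow> (nat \<Rightarrow> real ^ 'd)" where
  "act g X = (\<lambda>i. snd g i *\<^sub>R X (fst g i))"

definition missing :: "nat \<Rightarrow> (nat \<Rightarrow> real ^ 'd) \<Rightarrow> signed_perm set" where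
  "missing n X = {g \<in> signed_perms n. 0 \<notin> walk_hull n (act g X)}"

text \<open>
  Linear dependence of an indexed family. Unlike \<open>dependent (v ` I)\<close>, a family with a
  repeated vector counts as dependent; see \<open>family_dependent_iff\<close> below.
\<close>

definition family_dependent :: "('i \<Rightarrow> real ^ 'd) \<Rightarrow> 'i set \<Rightarrow> bool" where
  "family_dependent v I \<longleftrightarrow> (\<exists>c. (\<exists>i\<in>I. c i \<noteq> 0) \<and> (\<Sum>i\<in>I. c i *\<^sub>R v i) = 0)"

definition degenerate_at :: "signed_perm \<Rightarrow> nat set \<Rightarrow> (nat \<Rightarrow> real ^ 'd) set" where
  "degenerate_at g I = {X. family_dependent (\<lambda>i. psum i (act g X)) I}"

definition degenerate :: "nat \<Rightarrow> (nat \<Rightarrow> real ^ 'd) set" where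
  "degenerate n =
    (\<Union>g \<in> signed_perms n. \<Union>I \<in> {I. I \<subseteq> {1..n} \<and> card I = CARD('d)}. degenerate_at g I)"

definition regular_config :: "nat \<Rightarrow> (nat \<Rightarrow> real ^ 'd) \<Rightarrow> bool" where
  "regular_config n X \<longleftrightarrow> X \<notin> degenerate n"

definition B_stirling :: "nat \<Rightarrow> int \<Rightarrow> int" where
  "B_stirling n k =
    (if k < 0 then 0 else coeff (\<Prod>i = 1..n. [:2 * int i - 1, 1:]) (nat k))"

lemma card_signed_perms: "card (signed_perms n) = 2 ^ n * fact n"
  by (simp add: signed_perms_def card_cartesian_product card_permutations card_PiE numeral_2_eq_2)

lemma degree_B_poly: "degree (\<Prod>i = 1..n. [:2 * int i - 1, 1:]) = n"
  by (subst degree_prod_eq_sum_degree) auto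

lemma B_stirling_eq_0: "k \<notin> {0..int n} \<Longrightarrow> B_stirling n k = 0"
  unfolding B_stirling_def by (auto intro!: coeff_eq_0 simp: degree_B_poly simp del: One_nat_def)

lemma B_stirling_generating:
  "(\<Prod>i = 1..n. t + (2 * int i - 1)) = (\<Sum>k\<le>n. B_stirling n (int k) * t ^ k)"
proof -
  have "(\<Prod>i = 1..n. t + (2 * int i - 1)) = poly (\<Prod>i = 1..n. [:2 * int i - 1, 1:]) t"
    by (simp add: poly_prod add.commute)
  also have "\<dots> = (\<Sum>k\<le>n. B_stirling n (int k) * t ^ k)"
    by (simp add: poly_altdef degree_B_poly B_stirling_def del: One_nat_def)
  finally show ?thesis .
qed

lemma family_dependent_iff:
  assumes "finite I"
  shows "family_dependent v I \<longleftrightarrow> \<not> inj_on v I \<or> dependent (v ` I)"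
proof (cases "inj_on v I")
  case True
  have "family_dependent v I \<longleftrightarrow> dependent (v ` I)"
  proof
    assume "family_dependent v I"
    then obtain c i where c: "i \<in> I" "c i \<noteq> 0" "(\<Sum>i\<in>I. c i *\<^sub>R v i) = 0"
      unfolding family_dependent_def by blast
    have "(\<Sum>w\<in>v ` I. c (the_inv_into I v w) *\<^sub>R w) = 0"
      using True c by (simp add: sum.reindex the_inv_into_f_f)
    moreover have "c (the_inv_into I v (v i)) \<noteq> 0"
      using True c by (simp add: the_inv_into_f_f)
    ultimately show "dependent (v ` I)"
      using assms c(1)
      by (subst dependent_finite) (auto intro!: exI[of _ "\<lambda>w. c (the_inv_into I v w)"])
  next
    assume "dependent (v ` I)"
    then obtain u w where "w \<in> v ` I" "u w \<noteq> 0" "(\<Sum>w\<in>v ` I. u w *\<^sub>R w) = 0"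
      using assms by (subst (asm) dependent_finite) auto
    then show "family_dependent v I"
      using True unfolding family_dependent_def
      by (intro exI[of _ "\<lambda>i. u (v i)"]) (auto simp: sum.reindex)
  qed
  with True show ?thesis by simp
next
  case False
  then obtain i j where ij: "i \<in> I" "j \<in> I" "i \<noteq> j" "v i = v j"
    by (auto simp: inj_on_def)
  define c where "c = (\<lambda>k. if k = i then 1 else if k = j then -1 else 0 :: real)"
  have "(\<Sum>k\<in>I. c k *\<^sub>R v k) = (\<Sum>k\<in>{i, j}. c k *\<^sub>R v k)"
    using assms ij by (intro sum.mono_neutral_right) (auto simp: c_def)
  also have "\<dots> = 0" using ij by (simp add: c_def)
  finally have "family_dependent v I"
    unfolding family_dependent_def using ij by (intro exI[of _ c]) (auto simp: c_def)
  with False show ?thesis by simp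
qed

end

theory Submission
  imports Defs
begin

text \<open>
  Abel summation turns a convex combination of the \<open>s\<^sub>k(gX)\<close> that vanishes into a nonzero
  \<open>y \<in> ker X\<close> lying in the closed Weyl chamber of type B that belongs to \<open>g\<close>, and regularity
  lets \<open>y\<close> be moved into the open chamber. So \<open>2\<^sup>n n! - |M(X)|\<close> is the number of regions into
  which the type B arrangement cuts \<open>ker X\<close>. Regularity says that every nonzero vector of
  \<open>ker X\<close> has more than \<open>d\<close> distinct nonzero absolute values among its coordinates; in this form
  it is inherited when a coordinate is forgotten (with \<open>d - 1\<close>) and when the last coordinate is
  identified with \<open>0\<close> or plus or minus another one (with the same \<open>d\<close>). Adding the hyperplanes of the last
  coordinate one at a time, deletion and restriction give
  \<open>N(n, d) = N(n - 1, d - 1) + (2n - 1) N(n - 1, d)\<close>, the recurrence of the B-Stirling numbers.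
\<close>

section \<open>Subspaces of finite dimension\<close>

text \<open>The induction runs over subspaces \<open>L\<close> and not over configurations:
  otherwise each restriction would call for a new configuration proved regular, whereas
  \<open>generic\<close> passes on by counting absolute values. Forgetting a coordinate leaves
  \<open>L\<close> itself unchanged, so all \<open>n\<close> share one ambient space, possibly of
  infinite dimension; \<open>has_dim\<close> therefore asserts a finite basis. Two boundaries shape
  the argument. For \<open>m = 0\<close> and positive \<open>n\<close> there are no regions, so
  twice the alternating sum must be \<open>2 ^ n * fact n\<close>: the factor \<open>t + 1\<close>
  makes the generating polynomial vanish at -1, hence the coefficients of either parity sum to half
  of its value at 1. For \<open>d = 0\<close> no genericity is left to spend on a forgotten
  coordinate, and deletion is identified with a restriction instead. The numbers
  \<open>2 ^ n * fact n\<close> satisfy the recurrence themselves, being multiplied by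
  \<open>1 + (2 * n + 1)\<close> at each step; hence so does their difference from the region
  counts, which is the number of missing signed permutations.\<close>

definition has_dim :: "nat \<Rightarrow> 'v::real_vector set \<Rightarrow> bool" where
  "has_dim m L \<longleftrightarrow> (\<exists>B. finite B \<and> independent B \<and> span B = L \<and> card B = m)"

lemma has_dim_subspace: "has_dim m L \<Longrightarrow> subspace L"
  by (auto simp: has_dim_def)

lemma has_dim_0_iff [simp]: "has_dim 0 L \<longleftrightarrow> L = {0}"
proof
  assume "L = {0}"
  then show "has_dim 0 L" unfolding has_dim_def by (intro exI[of _ "{}"]) (auto simp: independent_empty)
qed (auto simp: has_dim_def)

text \<open>Projecting along a basis vector \<open>b\<close> with \<open>f b\<close> nonzero sends
  the remaining basis vectors into the kernel; it is injective on their span because it annihilates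
  only multiples of \<open>b\<close>.\<close>

lemma has_dim_kernel:
  fixes f :: "'v::real_vector \<Rightarrow> real"
  assumes "has_dim m L" "linear f" "w \<in> L" "f w \<noteq> 0"
  shows "\<exists>k. m = Suc k \<and> has_dim k (L \<inter> {y. f y = 0})"
proof -
  obtain B where B: "finite B" "independent B" "span B = L" "card B = m"
    using assms(1) by (auto simp: has_dim_def)
  interpret f: linear f by fact
  have "\<exists>b\<in>B. f b \<noteq> 0"
  proof (rule ccontr)
    assume "\<not> ?thesis"
    then have "f w = 0"
      using linear_eq_0_on_span[OF assms(2)] assms(3) B(3) by blast
    then show False using assms(4) by simp
  qed
  then obtain b where b: "b \<in> B" "f b \<noteq> 0" by blast
  define p where "p v = v - (f v / f b) *\<^sub>R b" for v
  have p: "linear p"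
    unfolding p_def by (rule linearI) (auto simp: f.add f.scaleR algebra_simps add_divide_distrib)
  interpret p: linear p by fact
  have fp: "f (p v) = 0" for v
    using b by (simp add: p_def f.diff f.scaleR)
  have b_notin: "b \<notin> span (B - {b})"
    using B(2) b(1) by (auto simp: dependent_def)
  have inj: "inj_on p (span (B - {b}))"
  proof (subst linear_inj_on_iff_eq_0[OF p subspace_span])
    show "\<forall>v\<in>span (B - {b}). p v = 0 \<longrightarrow> v = 0"
    proof safe
      fix v assume v: "v \<in> span (B - {b})" "p v = 0"
      show "v = 0"
      proof (cases "f v = 0")
        case True then show ?thesis using v by (simp add: p_def)
      next
        case False
        have "b = (f b / f v) *\<^sub>R v"
          using v(2) False b(2) by (simp add: p_def) (metis (no_types, lifting) divide_divide_eq_right divide_self_if mult.commute nonzero_mult_div_cancel_left scaleR_one scaleR_scaleR times_divide_eq_left)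
        then have "b \<in> span (B - {b})" using v(1) by (metis span_scale)
        then show ?thesis using b_notin by blast
      qed
    qed
  qed
  have ind: "independent (B - {b})" by (rule independent_mono[OF B(2)]) blast
  have "independent (p ` (B - {b}))"
    using ind inj by (rule linear_independent_injective_image[OF p])
  moreover have "card (p ` (B - {b})) = card B - 1"
    using inj_on_subset[OF inj span_superset] B(1) b(1) by (simp add: card_image)
  moreover have "span (p ` (B - {b})) = L \<inter> {y. f y = 0}"
  proof safe
    fix v assume "v \<in> span (p ` (B - {b}))"
    then have "v \<in> p ` span (B - {b})" by (simp add: linear_span_image[OF p])
    then obtain u where u: "u \<in> span (B - {b})" "v = p u" by blast
    have "u \<in> L" using u(1) B(3) span_mono[of "B - {b}" B] by blast
    moreover have "b \<in> L" using b(1) B(3) span_base by blast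
    ultimately show "v \<in> L" unfolding u(2) p_def B(3)[symmetric]
      by (intro span_diff span_scale)
    show "f v = 0" by (simp add: u fp)
  next
    fix v assume v: "v \<in> L" "f v = 0"
    have "p b = 0" using b by (simp add: p_def)
    obtain k where k: "v - k *\<^sub>R b \<in> span (B - {b})"
      using span_breakdown[of b B v] v(1) B(3) b(1) by blast
    have "p (v - k *\<^sub>R b) = v" using v(2) \<open>p b = 0\<close> by (simp add: p.diff p.scaleR) (simp add: p_def)
    then show "v \<in> span (p ` (B - {b}))" using k by (metis linear_span_image[OF p] imageI)
  qed
  moreover have "card B > 0" using B b(1) by (auto simp: card_gt_0_iff)
  moreover have "finite (p ` (B - {b}))" using B(1) by simp
  ultimately have "m = Suc (m - 1)" "has_dim (m - 1) (L \<inter> {y. f y = 0})"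
    unfolding has_dim_def B(4)[symmetric] by auto
  then show ?thesis by blast
qed

text \<open>A form that already vanishes on the current subspace costs no dimension, so only a lower
  bound on \<open>k\<close> results.\<close>

lemma has_dim_kernels:
  fixes f :: "'i \<Rightarrow> 'v::real_vector \<Rightarrow> real"
  assumes "finite F" "has_dim m L" "\<And>i. i \<in> F \<Longrightarrow> linear (f i)"
  shows "\<exists>k. m \<le> k + card F \<and> has_dim k {y \<in> L. \<forall>i\<in>F. f i y = 0}"
  using assms(1,3)
proof (induction F)
  case empty
  then show ?case using assms(2) by auto
next
  case (insert i F)
  then obtain k where k: "m \<le> k + card F" "has_dim k {y \<in> L. \<forall>i\<in>F. f i y = 0}" by auto
  let ?K = "{y \<in> L. \<forall>i\<in>F. f i y = 0}"
  have eq: "{y \<in> L. \<forall>j\<in>insert i F. f j y = 0} = ?K \<inter> {y. f i y = 0}" by auto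
  show ?case
  proof (cases "\<exists>w\<in>?K. f i w \<noteq> 0")
    case True
    then obtain k' where "k = Suc k'" "has_dim k' (?K \<inter> {y. f i y = 0})"
      using has_dim_kernel[OF k(2)] insert.prems by blast
    then show ?thesis using k insert.hyps unfolding eq by auto
  next
    case False
    then have "?K \<inter> {y. f i y = 0} = ?K" by blast
    then show ?thesis using k insert.hyps unfolding eq by (intro exI[of _ k]) auto
  qed
qed

lemma common_zero:
  fixes f :: "'i \<Rightarrow> 'v::real_vector \<Rightarrow> real"
  assumes "finite F" "has_dim m L" "\<And>i. i \<in> F \<Longrightarrow> linear (f i)" "card F < m"
  obtains w where "w \<in> L" "w \<noteq> 0" "\<And>i. i \<in> F \<Longrightarrow> f i w = 0"
proof -
  obtain k where k: "m \<le> k + card F" "has_dim k {y \<in> L. \<forall>i\<in>F. f i y = 0}"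
    using has_dim_kernels[of F m L f] assms by blast
  then obtain B where B: "independent B" "span B = {y \<in> L. \<forall>i\<in>F. f i y = 0}" "card B = k"
    by (auto simp: has_dim_def)
  have "B \<noteq> {}" using B(3) k(1) assms(4) by auto
  then obtain w where w: "w \<in> B" by blast
  then have "w \<noteq> 0" using B(1) dependent_zero by blast
  moreover have "w \<in> {y \<in> L. \<forall>i\<in>F. f i y = 0}" using w B(2) span_base by blast
  ultimately show ?thesis using that by blast
qed

section \<open>Regions of a hyperplane arrangement\<close>

text \<open>Both labellings have the same fibres on \<open>S\<close>. This lets regions be counted
  by any complete label: a sign pattern, part of one, or a signed permutation.\<close>

lemma card_image_eq_card_image:
  assumes "\<And>x y. x \<in> S \<Longrightarrow> y \<in> S \<Longrightarrow> f x = f y \<longleftrightarrow> g x = g y"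
  shows "card (f ` S) = card (g ` S)"
proof (rule bij_betw_same_card)
  let ?h = "\<lambda>c. g (SOME x. x \<in> S \<and> f x = c)"
  have h: "?h (f x) = g x" if "x \<in> S" for x
  proof -
    have "\<exists>y. y \<in> S \<and> f y = f x" using that by blast
    then have "(SOME y. y \<in> S \<and> f y = f x) \<in> S \<and> f (SOME y. y \<in> S \<and> f y = f x) = f x"
      by (rule someI_ex)
    then show ?thesis using assms that by blast
  qed
  show "bij_betw ?h (f ` S) (g ` S)"
    unfolding bij_betw_def inj_on_def using h assms by (auto simp: image_iff)
qed

lemma perturbation_keeps_signs:
  fixes u v :: "'i \<Rightarrow> real"
  assumes "finite A" "\<And>i. i \<in> A \<Longrightarrow> u i \<noteq> 0"
  obtains e where "e > 0"
    "\<And>t i. \<bar>t\<bar> \<le> e \<Longrightarrow> i \<in> A \<Longrightarrow> u i + t * v i \<noteq> 0 \<and> (u i + t * v i > 0 \<longleftrightarrow> u i > 0)"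
proof -
  have "\<exists>e>0. \<forall>t i. \<bar>t\<bar> \<le> e \<longrightarrow> i \<in> A \<longrightarrow> u i + t * v i \<noteq> 0 \<and> (u i + t * v i > 0 \<longleftrightarrow> u i > 0)"
    using assms
  proof (induction A)
    case empty
    then show ?case by (intro exI[of _ 1]) auto
  next
    case (insert j A)
    then obtain e where e: "e > 0"
      "\<And>t i. \<bar>t\<bar> \<le> e \<Longrightarrow> i \<in> A \<Longrightarrow> u i + t * v i \<noteq> 0 \<and> (u i + t * v i > 0 \<longleftrightarrow> u i > 0)"
      by auto
    \<comment> \<open>Bounds the perturbation of \<open>u j\<close> by half its size; the added 1
      keeps the denominator positive when \<open>v j = 0\<close>.\<close>
    define e' where "e' = \<bar>u j\<bar> / (2 * (\<bar>v j\<bar> + 1))"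
    have uj: "u j \<noteq> 0" using insert by auto
    then have e': "e' > 0" by (auto simp: e'_def)
    have "u j + t * v j \<noteq> 0 \<and> (u j + t * v j > 0 \<longleftrightarrow> u j > 0)" if "\<bar>t\<bar> \<le> e'" for t
    proof -
      have "\<bar>t * v j\<bar> \<le> e' * (\<bar>v j\<bar> + 1)"
        unfolding abs_mult using that by (intro mult_mono) auto
      also have "\<dots> = \<bar>u j\<bar> / 2" by (simp add: e'_def divide_simps)
      finally show ?thesis using uj by linarith
    qed
    then show ?case using e e' by (intro exI[of _ "min e e'"]) auto
  qed
  then show ?thesis using that by blast
qed

definition sign_pattern :: "('i \<Rightarrow> 'v \<Rightarrow> real) \<Rightarrow> 'i set \<Rightarrow> 'v \<Rightarrow> 'i set" where
  "sign_pattern a A y = {i \<in> A. a i y > 0}"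

text \<open>Off the hyperplanes the positive forms determine the negative ones, and the points of a
  subspace with given signs form a convex set. Counting patterns thus counts regions without any
  topology.\<close>

definition regions :: "'v set \<Rightarrow> ('i \<Rightarrow> 'v \<Rightarrow> real) \<Rightarrow> 'i set \<Rightarrow> 'i set set" where
  "regions L a A = sign_pattern a A ` {y \<in> L. \<forall>i\<in>A. a i y \<noteq> 0}"

text \<open>Deletion and restriction. A region of \<open>A\<close> survives undivided unless the new hyperplane
  meets it, in which case it is cut into two.\<close>

lemma card_regions_insert:
  fixes a :: "'i \<Rightarrow> 'v::real_vector \<Rightarrow> real"
  assumes "subspace L" "finite A" "h \<notin> A" and lin: "\<And>i. linear (a i)"
    and w: "w \<in> L" "a h w \<noteq> 0"
  shows "card (regions L a (insert h A)) =
    card (regions L a A) + card (regions (L \<inter> {y. a h y = 0}) a A)"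
proof -
  let ?R = "regions L a (insert h A)"
  let ?S = "{y \<in> L. \<forall>i\<in>A. a i y \<noteq> 0}"
  let ?P = "sign_pattern a A ` {y \<in> ?S. a h y < 0}" and ?M = "sign_pattern a A ` {y \<in> ?S. a h y > 0}"
  have lc: "a i (x *\<^sub>R y + x' *\<^sub>R y') = x * a i y + x' * a i y'" for i x x' y y'
    by (simp add: linear_add[OF lin] linear_cmul[OF lin])
  have lc': "a i (y + x' *\<^sub>R y') = a i y + x' * a i y'" for i x' y y'
    by (simp add: linear_add[OF lin] linear_cmul[OF lin])
  have memP: "Q \<in> ?P \<longleftrightarrow> (\<exists>y\<in>L. (\<forall>i\<in>A. a i y \<noteq> 0) \<and> a h y < 0 \<and> Q = sign_pattern a A y)" for Q
    by blast
  have memM: "Q \<in> ?M \<longleftrightarrow> (\<exists>y\<in>L. (\<forall>i\<in>A. a i y \<noteq> 0) \<and> a h y > 0 \<and> Q = sign_pattern a A y)" for Q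
    by blast
  have sub: "sign_pattern a A y \<subseteq> A" for y by (auto simp: sign_pattern_def)
  have "{y \<in> L. \<forall>i\<in>insert h A. a i y \<noteq> 0} = {y \<in> ?S. a h y < 0} \<union> {y \<in> ?S. a h y > 0}"
    by (auto simp: neq_iff)
  then have "?R = sign_pattern a (insert h A) ` {y \<in> ?S. a h y < 0} \<union>
      sign_pattern a (insert h A) ` {y \<in> ?S. a h y > 0}"
    unfolding regions_def by (simp add: image_Un)
  \<comment> \<open>On the negative side \<open>h\<close> does not enter the pattern, on the
    positive side it is adjoined; a pattern over \<open>A\<close> seen on both sides is therefore
    counted twice.\<close>
  also have "sign_pattern a (insert h A) ` {y \<in> ?S. a h y < 0} = ?P"
    by (rule image_cong) (auto simp: sign_pattern_def)
  also have "sign_pattern a (insert h A) ` {y \<in> ?S. a h y > 0} = insert h ` ?M"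
    unfolding image_image by (rule image_cong) (auto simp: sign_pattern_def)
  finally have "?R = ?P \<union> insert h ` ?M" .
  moreover have "?P \<inter> insert h ` ?M = {}"
    using \<open>h \<notin> A\<close> by (auto simp: sign_pattern_def)
  moreover have "inj_on (insert h) ?M"
  proof (rule inj_onI)
    fix Q Q' assume "Q \<in> ?M" "Q' \<in> ?M" "insert h Q = insert h Q'"
    moreover from this have "h \<notin> Q" "h \<notin> Q'" using sub \<open>h \<notin> A\<close> by (auto simp: sign_pattern_def)
    ultimately show "Q = Q'" using insert_ident by metis
  qed
  moreover have fin: "finite (sign_pattern a A ` S)" for S
    by (rule finite_subset[of _ "Pow A"]) (use sub \<open>finite A\<close> in auto)
  ultimately have "card ?R = card ?P + card ?M"
    by (simp add: card_Un_disjoint[OF fin finite_imageI[OF fin]] card_image)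
  also have "\<dots> = card (?P \<union> ?M) + card (?P \<inter> ?M)"
    using fin fin by (rule card_Un_Int)
  also have "?P \<union> ?M = regions L a A"
  proof (intro equalityI subsetI)
    fix Q assume "Q \<in> ?P \<union> ?M"
    then show "Q \<in> regions L a A" unfolding Un_iff memP memM regions_def by blast
  next
    fix Q assume "Q \<in> regions L a A"
    then obtain y where y: "y \<in> L" "\<And>i. i \<in> A \<Longrightarrow> a i y \<noteq> 0" "Q = sign_pattern a A y"
      by (auto simp: regions_def)
    obtain e where e: "e > 0" "\<And>t i. \<bar>t\<bar> \<le> e \<Longrightarrow> i \<in> A \<Longrightarrow>
        a i y + t * a i w \<noteq> 0 \<and> (a i y + t * a i w > 0 \<longleftrightarrow> a i y > 0)"
      using perturbation_keeps_signs[of A "\<lambda>i. a i y" "\<lambda>i. a i w"] assms(2) y(2) by blast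
    \<comment> \<open>Only a point on the new hyperplane has to be moved, and \<open>w\<close> leads
      off it.\<close>
    obtain t where t: "\<bar>t\<bar> \<le> e" "a h y + t * a h w \<noteq> 0"
    proof (cases "a h y = 0")
      case True then show ?thesis using that[of e] e(1) w(2) by simp
    next
      case False then show ?thesis using that[of 0] e(1) by simp
    qed
    have "y + t *\<^sub>R w \<in> L" using y(1) w(1) assms(1) by (simp add: subspace_add subspace_scale)
    moreover have "Q = sign_pattern a A (y + t *\<^sub>R w)"
      using e(2)[OF t(1)] y(3) by (auto simp: sign_pattern_def lc')
    moreover have "\<forall>i\<in>A. a i (y + t *\<^sub>R w) \<noteq> 0"
      using e(2)[OF t(1)] by (simp add: lc')
    moreover have "a h (y + t *\<^sub>R w) < 0 \<or> a h (y + t *\<^sub>R w) > 0"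
      using t(2) by (auto simp: lc')
    ultimately show "Q \<in> ?P \<union> ?M"
      unfolding Un_iff memP memM by blast
  qed
  also have "?P \<inter> ?M = regions (L \<inter> {y. a h y = 0}) a A"
  proof (intro equalityI subsetI)
    fix Q assume "Q \<in> ?P \<inter> ?M"
    then obtain y z where y: "y \<in> L" "\<forall>i\<in>A. a i y \<noteq> 0" "a h y < 0" "Q = sign_pattern a A y"
      and z: "z \<in> L" "\<forall>i\<in>A. a i z \<noteq> 0" "a h z > 0" "Q = sign_pattern a A z"
      unfolding Int_iff memP memM by blast
    \<comment> \<open>Up to a positive factor, the point where the segment from \<open>y\<close> to
      \<open>z\<close> crosses the hyperplane of \<open>h\<close>. Both coefficients are positive,
      so common signs survive.\<close>
    define x where "x = a h z *\<^sub>R y + (- a h y) *\<^sub>R z"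
    have same: "a i y > 0 \<longleftrightarrow> a i z > 0" if "i \<in> A" for i
      using y(4) z(4) that by (auto simp: sign_pattern_def)
    have sg: "a i x \<noteq> 0 \<and> (a i x > 0 \<longleftrightarrow> a i y > 0)" if "i \<in> A" for i
    proof (cases "a i y > 0")
      case True
      then have "a i z > 0" using same that by blast
      then have "a h z * a i y + (- a h y) * a i z > 0"
        using True y(3) z(3) by (intro add_pos_pos mult_pos_pos) auto
      then show ?thesis using True unfolding x_def lc by auto
    next
      case False
      then have "a i z < 0" "a i y < 0" using same y(2) z(2) that by (force simp: not_less_iff_gr_or_eq)+
      then have "a h z * a i y + (- a h y) * a i z < 0"
        using y(3) z(3) by (intro add_neg_neg mult_pos_neg) auto
      then show ?thesis using False unfolding x_def lc by auto
    qed
    have "a h x = 0" unfolding x_def lc by simp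
    moreover have "x \<in> L" unfolding x_def
      by (intro subspace_add subspace_scale assms(1) y z)
    moreover have "Q = sign_pattern a A x" using y(4) sg by (auto simp: sign_pattern_def)
    ultimately show "Q \<in> regions (L \<inter> {y. a h y = 0}) a A"
      unfolding regions_def using sg by blast
  next
    fix Q assume "Q \<in> regions (L \<inter> {y. a h y = 0}) a A"
    then obtain y where y: "y \<in> L" "a h y = 0" "\<And>i. i \<in> A \<Longrightarrow> a i y \<noteq> 0" "Q = sign_pattern a A y"
      by (auto simp: regions_def)
    obtain e where e: "e > 0" "\<And>t i. \<bar>t\<bar> \<le> e \<Longrightarrow> i \<in> A \<Longrightarrow>
        a i y + t * a i w \<noteq> 0 \<and> (a i y + t * a i w > 0 \<longleftrightarrow> a i y > 0)"
      using perturbation_keeps_signs[of A "\<lambda>i. a i y" "\<lambda>i. a i w"] assms(2) y(3) by blast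
    have both: "y + t *\<^sub>R w \<in> L" "\<forall>i\<in>A. a i (y + t *\<^sub>R w) \<noteq> 0" "Q = sign_pattern a A (y + t *\<^sub>R w)"
        "a h (y + t *\<^sub>R w) = t * a h w" if "\<bar>t\<bar> \<le> e" for t
      using e(2)[OF that] y w(1) assms(1)
      by (auto simp: subspace_add subspace_scale lc' sign_pattern_def)
    \<comment> \<open>The sign makes \<open>?t\<close> lead to the positive side of the hyperplane
      and \<open>- ?t\<close> to the negative one.\<close>
    let ?t = "e * sgn (a h w)"
    have t: "\<bar>?t\<bar> \<le> e" "?t * a h w > 0" "\<bar>- ?t\<bar> \<le> e" "- ?t * a h w < 0"
      using e(1) w(2) by (auto simp: abs_mult sgn_if mult_less_0_iff)
    show "Q \<in> ?P \<inter> ?M"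
    proof
      show "Q \<in> ?P" unfolding memP using both[OF t(3)] t(4) by (intro bexI[of _ "y + (- ?t) *\<^sub>R w"]) auto
      show "Q \<in> ?M" unfolding memM using both[OF t(1)] t(2) by (intro bexI[of _ "y + ?t *\<^sub>R w"]) auto
    qed
  qed
  finally show ?thesis .
qed

text \<open>On \<open>L\<close> the sign of a form in \<open>F\<close> is dictated by a form in
  \<open>A\<close>, so these hyperplanes only repeat old ones.\<close>

lemma card_regions_redundant:
  fixes a :: "'i \<Rightarrow> 'v \<Rightarrow> real"
  assumes "\<And>h. h \<in> F \<Longrightarrow> \<exists>k\<in>A. \<exists>c. c \<noteq> 0 \<and> (\<forall>y\<in>L. a h y = c * a k y)"
  shows "card (regions L a (A \<union> F)) = card (regions L a A)"
proof -
  have dom: "{y \<in> L. \<forall>i\<in>A \<union> F. a i y \<noteq> 0} = {y \<in> L. \<forall>i\<in>A. a i y \<noteq> 0}"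
    using assms by fastforce
  have "sign_pattern a (A \<union> F) y = sign_pattern a (A \<union> F) z \<longleftrightarrow>
      sign_pattern a A y = sign_pattern a A z"
    if "y \<in> {y \<in> L. \<forall>i\<in>A. a i y \<noteq> 0}" "z \<in> {y \<in> L. \<forall>i\<in>A. a i y \<noteq> 0}" for y z
  proof
    assume "sign_pattern a (A \<union> F) y = sign_pattern a (A \<union> F) z"
    then show "sign_pattern a A y = sign_pattern a A z" by (auto simp: sign_pattern_def set_eq_iff)
  next
    assume "sign_pattern a A y = sign_pattern a A z"
    then have A: "a k y > 0 \<longleftrightarrow> a k z > 0" if "k \<in> A" for k
      using that by (auto simp: sign_pattern_def set_eq_iff)
    have "a h y > 0 \<longleftrightarrow> a h z > 0" if h: "h \<in> F" for h
    proof -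
      obtain k c where k: "k \<in> A" "c \<noteq> 0" "\<forall>y\<in>L. a h y = c * a k y" using assms[OF h] by blast
      have "a h y = c * a k y" "a h z = c * a k z" "a k y \<noteq> 0" "a k z \<noteq> 0"
        using k \<open>y \<in> _\<close> \<open>z \<in> _\<close> by auto
      then show ?thesis using A[OF k(1)] k(2) by (auto simp: zero_less_mult_iff)
    qed
    then show "sign_pattern a (A \<union> F) y = sign_pattern a (A \<union> F) z"
      using A by (auto simp: sign_pattern_def set_eq_iff)
  qed
  then show ?thesis
    unfolding regions_def dom by (rule card_image_eq_card_image)
qed

text \<open>Every application of deletion and restriction adds the same number \<open>c\<close>. The
  last hypothesis ranges over all \<open>F'\<close> because each restriction also carries the traces
  of the hyperplanes added earlier.\<close>

lemma card_regions_Un: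
  fixes a :: "'i \<Rightarrow> 'v::real_vector \<Rightarrow> real"
  assumes "finite F" "subspace L" "finite A" "F \<inter> A = {}" and lin: "\<And>i. linear (a i)"
    and "\<And>h. h \<in> F \<Longrightarrow> \<exists>w\<in>L. a h w \<noteq> 0"
    and "\<And>h F'. h \<in> F \<Longrightarrow> F' \<subseteq> F - {h} \<Longrightarrow> card (regions (L \<inter> {y. a h y = 0}) a (A \<union> F')) = c"
  shows "card (regions L a (A \<union> F)) = card (regions L a A) + card F * c"
  using assms(1,4,6,7)
proof (induction F)
  case empty
  then show ?case by simp
next
  case (insert h F)
  obtain w where w: "w \<in> L" "a h w \<noteq> 0" using insert.prems by blast
  have "h \<notin> A \<union> F" "finite (A \<union> F)" using insert.prems(1) insert.hyps assms(3) by auto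
  moreover have "card (regions (L \<inter> {y. a h y = 0}) a (A \<union> F)) = c"
    using insert.hyps by (intro insert.prems(3)) auto
  ultimately have "card (regions L a (insert h (A \<union> F))) = card (regions L a (A \<union> F)) + c"
    using card_regions_insert[where a = a, OF assms(2) _ _ lin w] by metis
  moreover have "card (regions L a (A \<union> F)) = card (regions L a A) + card F * c"
  proof (rule insert.IH)
    show "F \<inter> A = {}" using insert.prems(1) by blast
    show "\<exists>w\<in>L. a h w \<noteq> 0" if "h \<in> F" for h using insert.prems(2) that by blast
    show "card (regions (L \<inter> {y. a h y = 0}) a (A \<union> F')) = c" if "h \<in> F" "F' \<subseteq> F - {h}" for h F'
      using that by (intro insert.prems(3)) auto
  qed
  ultimately show ?case using insert.hyps by simp
qed

section \<open>The alternating sums of Stirling numbers\<close>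

lemma B_stirling_0: "B_stirling 0 k = (if k = 0 then 1 else 0)"
  by (auto simp: B_stirling_def coeff_eq_0 nat_eq_iff)

lemma B_stirling_Suc:
  "B_stirling (Suc n) k = B_stirling n (k - 1) + (2 * int n + 1) * B_stirling n k"
proof -
  let ?P = "\<Prod>i = 1..n. [:2 * int i - 1, 1:]"
  have P: "(\<Prod>i = 1..Suc n. [:2 * int i - 1, 1:]) = smult (2 * int n + 1) ?P + pCons 0 ?P"
    by (simp add: mult.commute[of _ "[:_, _:]"] add.commute)
  show ?thesis
  proof (cases "k \<ge> 1")
    case True
    then have "nat k = Suc (nat (k - 1))" by simp
    then show ?thesis using True unfolding B_stirling_def P by simp
  next
    case False
    then show ?thesis unfolding B_stirling_def P by auto
  qed
qed

definition stirling_sum :: "nat \<Rightarrow> nat \<Rightarrow> int" where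
  "stirling_sum n d = (\<Sum>q. B_stirling n (int d - 1 - 2 * int q))"

text \<open>The bound \<open>N\<close> is left free so that sums for different \<open>d\<close> can
  be brought to one range and added.\<close>

lemma stirling_sum_eq:
  assumes "d \<le> N"
  shows "stirling_sum n d = (\<Sum>q<N. B_stirling n (int d - 1 - 2 * int q))"
  unfolding stirling_sum_def using assms
  by (intro suminf_finite B_stirling_eq_0) auto

lemma stirling_sum_0_right [simp]: "stirling_sum n 0 = 0"
  by (simp add: stirling_sum_eq[of 0 0])

lemma stirling_sum_Suc_Suc:
  "stirling_sum (Suc n) (Suc d) = stirling_sum n d + (2 * int n + 1) * stirling_sum n (Suc d)"
proof -
  \<comment> \<open>The shift of \<open>k\<close> in the recurrence of the coefficients becomes a
    lowering of \<open>d\<close>.\<close>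
  have "int (Suc d) - 1 - 2 * int q - 1 = int d - 1 - 2 * int q" for q by simp
  then show ?thesis
    by (simp only: stirling_sum_eq[of _ "Suc d"] le_SucI order_refl B_stirling_Suc
        sum.distrib sum_distrib_left)
qed

lemma stirling_sum_0_left: "stirling_sum 0 d = (if odd d then 1 else 0)"
proof -
  have "stirling_sum 0 d = (\<Sum>q<d. if odd d \<and> q = d div 2 then 1 else 0)"
  proof -
    have "int d - 1 - 2 * int q = 0 \<longleftrightarrow> odd d \<and> q = d div 2" for q by presburger
    then show ?thesis unfolding stirling_sum_eq[OF order_refl] B_stirling_0 by simp
  qed
  also have "\<dots> = (if odd d then 1 else 0)"
    by (cases "odd d") (auto simp: odd_pos)
  finally show ?thesis .
qed

text \<open>For \<open>n \<le> d\<close> the sum takes in every coefficient of one parity. The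
  induction starts at 1, since for \<open>n = 0\<close> the value depends on the parity of
  \<open>d\<close>; at 1 the two summands belong to consecutive numbers, exactly one of them
  odd.\<close>

lemma stirling_sum_saturated:
  assumes "0 < n" "n \<le> d"
  shows "2 * stirling_sum n d = 2 ^ n * fact n"
  using assms
proof (induction n arbitrary: d)
  case (Suc n)
  then obtain d' where d: "d = Suc d'" by (cases d) auto
  show ?case
  proof (cases "n = 0")
    case True
    then show ?thesis unfolding d stirling_sum_Suc_Suc by (simp add: stirling_sum_0_left)
  next
    case False
    have "2 * stirling_sum (Suc n) d = 2 * stirling_sum n d' + (2 * int n + 1) * (2 * stirling_sum n (Suc d'))"
      unfolding d stirling_sum_Suc_Suc by (simp add: algebra_simps)
    also have "\<dots> = 2 ^ n * fact n + (2 * int n + 1) * (2 ^ n * fact n)"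
      using Suc.IH[of d'] Suc.IH[of "Suc d'"] Suc.prems False d by simp
    finally show ?thesis by (simp add: algebra_simps)
  qed
qed simp

section \<open>The arrangement of type B\<close>

text \<open>The hyperplanes \<open>y\<^sub>k = 0\<close> and \<open>y\<^sub>k = \<plusminus>y\<^sub>j\<close> become uniformly \<open>y\<^sub>k = y\<^sub>j\<close> with \<open>\<bar>j\<bar> < k\<close>
  once coordinates are extended to all integers by \<open>y\<^bsub>-j\<^esub> = -y\<^sub>j\<close>.\<close>

definition type_B :: "nat \<Rightarrow> (int \<times> int) set" where
  "type_B n = {(k, j). 1 \<le> k \<and> k \<le> int n \<and> \<bar>j\<bar> < k}"

lemma finite_type_B: "finite (type_B n)"
  by (rule finite_subset[of _ "{1..int n} \<times> {- int n..int n}"]) (auto simp: type_B_def)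

lemma type_B_Suc: "type_B (Suc n) = type_B n \<union> {int (Suc n)} \<times> {- int n..int n}"
  by (auto simp: type_B_def)

section \<open>Generic subspaces and how genericity is inherited\<close>

text \<open>Coordinates are linear forms on an unspecified space, so that lowering \<open>n\<close>
  merely ignores a form.\<close>

locale signed_coordinates =
  fixes f :: "int \<Rightarrow> 'v::real_vector \<Rightarrow> real"
  assumes linear_f: "linear (f j)"
    and f_minus: "f (- j) y = - f j y"
begin

definition diff_form :: "int \<times> int \<Rightarrow> 'v \<Rightarrow> real" where
  "diff_form h y = f (fst h) y - f (snd h) y"

definition abs_values :: "nat \<Rightarrow> 'v \<Rightarrow> real set" where
  "abs_values n y = (\<lambda>i. \<bar>f i y\<bar>) ` {1..int n} - {0}"

text \<open>For the kernel \<open>L\<close> of a configuration in \<open>\<real>\<^sup>d\<close> this is a consequence of regularity: a vector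
  in a closed chamber with at most \<open>d\<close> distinct nonzero absolute values is a relation between at
  most \<open>d\<close> of the partial sums.\<close>

definition generic :: "nat \<Rightarrow> nat \<Rightarrow> 'v set \<Rightarrow> bool" where
  "generic n d L \<longleftrightarrow> (\<forall>y\<in>L. y \<noteq> 0 \<longrightarrow> d < card (abs_values n y))"

lemma linear_diff_form: "linear (diff_form h)"
  unfolding diff_form_def by (intro linear_compose_sub linear_f)

lemma f_0 [simp]: "f 0 y = 0"
  using f_minus[of 0 y] by simp

lemma f_abs: "\<bar>f \<bar>j\<bar> y\<bar> = \<bar>f j y\<bar>"
  by (cases "j \<ge> 0") (auto simp: f_minus)

lemma finite_abs_values: "finite (abs_values n y)"
  by (simp add: abs_values_def)

text \<open>The last absolute value is 0 or repeats an earlier one, so dropping it loses nothing and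
  \<open>d\<close> stays.\<close>

lemma generic_restrict:
  assumes "generic (Suc n) d L" "L' \<subseteq> L" "\<And>y. y \<in> L' \<Longrightarrow> f (int (Suc n)) y = f j y" "\<bar>j\<bar> \<le> int n"
  shows "generic n d L'"
  unfolding generic_def
proof (intro ballI impI)
  fix y assume y: "y \<in> L'" "y \<noteq> 0"
  have "abs_values (Suc n) y \<subseteq> abs_values n y"
  proof
    fix v assume "v \<in> abs_values (Suc n) y"
    then obtain i where i: "i \<in> {1..int (Suc n)}" "v = \<bar>f i y\<bar>" "v \<noteq> 0" by (auto simp: abs_values_def)
    show "v \<in> abs_values n y"
    proof (cases "i = int (Suc n)")
      case True
      then have v: "v = \<bar>f \<bar>j\<bar> y\<bar>" using i(2) assms(3)[OF y(1)] by (simp add: f_abs)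
      then have "\<bar>j\<bar> \<noteq> 0" using i(3) by auto
      then have "\<bar>j\<bar> \<in> {1..int n}" using assms(4) by auto
      then show ?thesis using v i(3) unfolding abs_values_def by blast
    next
      case False
      then show ?thesis using i by (auto simp: abs_values_def)
    qed
  qed
  then have "card (abs_values (Suc n) y) \<le> card (abs_values n y)"
    by (intro card_mono finite_abs_values)
  moreover have "d < card (abs_values (Suc n) y)" using assms(1,2) y unfolding generic_def by blast
  ultimately show "d < card (abs_values n y)" by simp
qed

text \<open>Dropping a coordinate loses at most one absolute value.\<close>

lemma generic_forget:
  assumes "generic (Suc n) (Suc d) L"
  shows "generic n d L"
  unfolding generic_def
proof (intro ballI impI)
  fix y assume y: "y \<in> L" "y \<noteq> 0"
  have "i = int (Suc n) \<or> i \<in> {1..int n}" if "i \<in> {1..int (Suc n)}" for i using that by auto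
  then have "abs_values (Suc n) y \<subseteq> insert \<bar>f (int (Suc n)) y\<bar> (abs_values n y)"
    unfolding abs_values_def by blast
  then have "card (abs_values (Suc n) y) \<le> card (insert \<bar>f (int (Suc n)) y\<bar> (abs_values n y))"
    by (intro card_mono) (auto simp: finite_abs_values)
  also have "\<dots> \<le> Suc (card (abs_values n y))" by (rule card_insert_le_m1) auto
  finally show "d < card (abs_values n y)" using assms y unfolding generic_def by force
qed

text \<open>In a larger space some nonzero vector vanishes in the first \<open>n - d\<close>
  coordinates, leaving at most \<open>d\<close> nonzero absolute values.\<close>

lemma generic_dim_le:
  assumes "generic n d L" "has_dim m L" "d \<le> n"
  shows "m + d \<le> n"
proof (rule ccontr)
  assume "\<not> m + d \<le> n"
  then have "card {1..int (n - d)} < m" using assms(3) by simp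
  then obtain w where w: "w \<in> L" "w \<noteq> 0" "\<And>i. i \<in> {1..int (n - d)} \<Longrightarrow> f i w = 0"
    using common_zero[of "{1..int (n - d)}" m L f] assms(2) linear_f by blast
  have "abs_values n w \<subseteq> (\<lambda>i. \<bar>f i w\<bar>) ` {int (n - d) + 1..int n}"
  proof
    fix v assume "v \<in> abs_values n w"
    then obtain i where i: "i \<in> {1..int n}" "v = \<bar>f i w\<bar>" "v \<noteq> 0" by (auto simp: abs_values_def)
    then have "i \<notin> {1..int (n - d)}" using w(3) by auto
    then show "v \<in> (\<lambda>i. \<bar>f i w\<bar>) ` {int (n - d) + 1..int n}" using i by auto
  qed
  then have "card (abs_values n w) \<le> card ((\<lambda>i. \<bar>f i w\<bar>) ` {int (n - d) + 1..int n})"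
    by (intro card_mono) auto
  also have "\<dots> \<le> card {int (n - d) + 1..int n}" by (rule card_image_le) auto
  also have "\<dots> = d" using assms(3) by simp
  finally show False using assms(1) w(1,2) unfolding generic_def by force
qed

text \<open>Swapping the two indices or negating both brings the index of larger size to the front
  with positive sign, which changes the form at most by a sign. If \<open>l = - j\<close> the form
  is twice a coordinate, whence the constants 2 and -2.\<close>

lemma diff_form_proportional:
  assumes "j \<noteq> l" "\<bar>j\<bar> \<le> int n" "\<bar>l\<bar> \<le> int n"
  shows "\<exists>k\<in>type_B n. \<exists>c. c \<noteq> 0 \<and> (\<forall>y. f j y - f l y = c * diff_form k y)"
proof -
  consider "\<bar>l\<bar> < \<bar>j\<bar>" "j > 0" | "\<bar>l\<bar> < \<bar>j\<bar>" "j < 0" | "\<bar>j\<bar> < \<bar>l\<bar>" "l > 0" | "\<bar>j\<bar> < \<bar>l\<bar>" "l < 0"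
    | "l = - j" "j > 0" | "l = - j" "j < 0"
    using assms(1) by linarith
  then show ?thesis
  proof cases
    case 1 then show ?thesis using assms
      by (intro bexI[of _ "(j, l)"] exI[of _ 1]) (auto simp: type_B_def diff_form_def)
  next
    case 2 then show ?thesis using assms
      by (intro bexI[of _ "(- j, - l)"] exI[of _ "- 1"]) (auto simp: type_B_def diff_form_def f_minus)
  next
    case 3 then show ?thesis using assms
      by (intro bexI[of _ "(l, j)"] exI[of _ "- 1"]) (auto simp: type_B_def diff_form_def)
  next
    case 4 then show ?thesis using assms
      by (intro bexI[of _ "(- l, - j)"] exI[of _ 1]) (auto simp: type_B_def diff_form_def f_minus)
  next
    case 5 then show ?thesis using assms
      by (intro bexI[of _ "(j, 0)"] exI[of _ 2]) (auto simp: type_B_def diff_form_def f_minus)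
  next
    case 6 then show ?thesis using assms
      by (intro bexI[of _ "(- j, 0)"] exI[of _ "- 2"]) (auto simp: type_B_def diff_form_def f_minus)
  qed
qed

text \<open>Serves the case \<open>d = 0\<close>. The dimension yields a vector \<open>w\<close> in
  \<open>L\<close> supported on the last coordinate alone; translating along \<open>w\<close> makes
  that coordinate 0 and changes no form of \<open>type_B n\<close>.\<close>

lemma regions_drop_free_coordinate:
  assumes "has_dim (Suc n) L" "generic (Suc n) 0 L"
  shows "regions L diff_form (type_B n) =
    regions (L \<inter> {y. f (int (Suc n)) y = 0}) diff_form (type_B n)"
proof (intro equalityI subsetI)
  fix Q assume "Q \<in> regions L diff_form (type_B n)"
  then obtain y where y: "y \<in> L" "\<forall>h\<in>type_B n. diff_form h y \<noteq> 0" "Q = sign_pattern diff_form (type_B n) y"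
    by (auto simp: regions_def)
  obtain w where w: "w \<in> L" "w \<noteq> 0" "\<And>i. i \<in> {1..int n} \<Longrightarrow> f i w = 0"
    using common_zero[of "{1..int n}" "Suc n" L f] assms(1) linear_f by auto
  have wN: "f (int (Suc n)) w \<noteq> 0"
  proof
    assume "f (int (Suc n)) w = 0"
    moreover have "i = int (Suc n) \<or> i \<in> {1..int n}" if "i \<in> {1..int (Suc n)}" for i using that by auto
    ultimately have "f i w = 0" if "i \<in> {1..int (Suc n)}" for i using that w(3) by metis
    then have "abs_values (Suc n) w = {}" unfolding abs_values_def by fastforce
    then show False using assms(2) w(1,2) unfolding generic_def by force
  qed
  have small: "f j w = 0" if "\<bar>j\<bar> \<le> int n" for j
  proof (cases "j = 0")
    case False
    then have "f \<bar>j\<bar> w = 0" using w(3)[of "\<bar>j\<bar>"] that by auto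
    then show ?thesis using f_abs[of j w] by simp
  qed simp
  define z where "z = y - (f (int (Suc n)) y / f (int (Suc n)) w) *\<^sub>R w"
  have fz: "f i z = f i y - (f (int (Suc n)) y / f (int (Suc n)) w) * f i w" for i
    unfolding z_def by (simp add: linear_diff[OF linear_f] linear_cmul[OF linear_f])
  have "z \<in> L" unfolding z_def
    using y(1) w(1) has_dim_subspace[OF assms(1)] by (intro subspace_diff subspace_scale)
  moreover have "f (int (Suc n)) z = 0" unfolding fz using wN by simp
  moreover have same: "diff_form h z = diff_form h y" if "h \<in> type_B n" for h
    using that by (auto simp: diff_form_def fz small type_B_def)
  moreover have "Q = sign_pattern diff_form (type_B n) z"
    using y(3) same by (auto simp: sign_pattern_def)
  ultimately show "Q \<in> regions (L \<inter> {y. f (int (Suc n)) y = 0}) diff_form (type_B n)"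
    unfolding regions_def using y(2) by auto
qed (auto simp: regions_def)

text \<open>Adding the \<open>2n + 1\<close> hyperplanes involving the last coordinate to the arrangement of
  rank \<open>n\<close>, each of them carries the full arrangement of rank \<open>n\<close>, because
  \<open>y\<^bsub>n+1\<^esub> = y\<^sub>l\<close> becomes \<open>y\<^sub>j = y\<^sub>l\<close> on \<open>y\<^bsub>n+1\<^esub> = y\<^sub>j\<close>. So the number of regions obeys
  the recurrence of the Stirling numbers.\<close>

theorem card_regions_type_B:
  assumes "has_dim m L" "m + d = n" "generic n d L"
  shows "int (card (regions L diff_form (type_B n))) = 2 ^ n * fact n - 2 * stirling_sum n d"
  using assms
proof (induction n arbitrary: m d L)
  case 0
  then have "L = {0}" "d = 0" "type_B 0 = {}" by (auto simp: type_B_def)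
  then show ?case by (simp add: regions_def)
next
  case (Suc n)
  show ?case
  proof (cases m)
    case 0
    then have "L = {0}" "d = Suc n" using Suc.prems by auto
    \<comment> \<open>There is at least one hyperplane, and it contains the only point of
      \<open>L\<close>.\<close>
    have "(1, 0) \<in> type_B (Suc n)" by (simp add: type_B_def)
    moreover have "diff_form (1, 0) 0 = 0" by (simp add: linear_0[OF linear_diff_form])
    ultimately have "regions L diff_form (type_B (Suc n)) = {}"
      unfolding regions_def \<open>L = {0}\<close> by blast
    then show ?thesis using stirling_sum_saturated[of "Suc n" d] \<open>d = Suc n\<close> by simp
  next
    case m: (Suc m')
    have md: "m' + d = n" using Suc.prems m by simp
    let ?F = "{int (Suc n)} \<times> {- int n..int n}"
    let ?c = "2 ^ n * fact n - 2 * stirling_sum n d"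
    have nonzero: "\<exists>w\<in>L. diff_form h w \<noteq> 0" if h: "h \<in> ?F" for h
    proof (rule ccontr)
      assume neg: "\<not> ?thesis"
      obtain j where j: "h = (int (Suc n), j)" "\<bar>j\<bar> \<le> int n" using h by auto
      \<comment> \<open>If \<open>L\<close> lay inside this hyperplane, it would be generic already
        with respect to \<open>n\<close> coordinates, for which its dimension
        \<open>n + 1 - d\<close> is too large.\<close>
      have "generic n d L"
        using neg j by (intro generic_restrict[OF Suc.prems(3), of L j]) (auto simp: diff_form_def)
      then have "m + d \<le> n" using generic_dim_le Suc.prems(1) md by auto
      then show False using Suc.prems(2) by simp
    qed
    have restr: "int (card (regions (L \<inter> {y. diff_form h y = 0}) diff_form (type_B n))) = ?c"
      if h: "h \<in> ?F" for h
    proof (rule Suc.IH[OF _ md])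
      obtain w where "w \<in> L" "diff_form h w \<noteq> 0" using nonzero[OF h] by blast
      then show "has_dim m' (L \<inter> {y. diff_form h y = 0})"
        using has_dim_kernel[OF Suc.prems(1) linear_diff_form] m by blast
      obtain j where j: "h = (int (Suc n), j)" "\<bar>j\<bar> \<le> int n" using h by auto
      show "generic n d (L \<inter> {y. diff_form h y = 0})"
        using j by (intro generic_restrict[OF Suc.prems(3), of _ j]) (auto simp: diff_form_def)
    qed
    have restr': "card (regions (L \<inter> {y. diff_form h y = 0}) diff_form (type_B n \<union> F')) = nat ?c"
      if h: "h \<in> ?F" "F' \<subseteq> ?F - {h}" for h F'
    proof -
      obtain j where j: "h = (int (Suc n), j)" "\<bar>j\<bar> \<le> int n" using h by auto
      have "card (regions (L \<inter> {y. diff_form h y = 0}) diff_form (type_B n \<union> F')) =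
          card (regions (L \<inter> {y. diff_form h y = 0}) diff_form (type_B n))"
      proof (rule card_regions_redundant)
        fix h' assume "h' \<in> F'"
        then obtain l where l: "h' = (int (Suc n), l)" "\<bar>l\<bar> \<le> int n" "j \<noteq> l" using h(2) j by force
        show "\<exists>k\<in>type_B n. \<exists>c. c \<noteq> 0 \<and>
            (\<forall>y\<in>L \<inter> {y. diff_form h y = 0}. diff_form h' y = c * diff_form k y)"
          using diff_form_proportional[OF l(3) j(2) l(2)] unfolding j(1) l(1)
          by (auto simp: diff_form_def)
      qed
      then show ?thesis using restr[OF h(1)] by linarith
    qed
    have mem: "(int (Suc n), 0) \<in> ?F" by auto
    \<comment> \<open>\<open>?c\<close> counts the regions of a restriction, so passing through
      \<open>nat\<close> loses nothing.\<close>
    have c0: "?c \<ge> 0" unfolding restr[OF mem, symmetric] by simp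
    have "card (regions L diff_form (type_B n \<union> ?F)) =
        card (regions L diff_form (type_B n)) + card ?F * nat ?c"
      using has_dim_subspace[OF Suc.prems(1)] nonzero restr' finite_type_B linear_diff_form
      by (intro card_regions_Un) (auto simp: type_B_def)
    then have rec: "int (card (regions L diff_form (type_B (Suc n)))) =
        int (card (regions L diff_form (type_B n))) + (2 * int n + 1) * ?c"
      using c0 by (simp add: type_B_Suc card_cartesian_product)
    have factor: "(2::int) ^ Suc n * fact (Suc n) = 2 * (int n + 1) * (2 ^ n * fact n)"
      by simp
    show ?thesis
    proof (cases d)
      case 0
      \<comment> \<open>The deletion term equals the restriction to the vanishing of the last
        coordinate, so \<open>?c\<close> occurs \<open>2 * n + 2\<close> times in all.\<close>
      have "diff_form (int (Suc n), 0) y = f (int (Suc n)) y" for y by (simp add: diff_form_def)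
      then have "int (card (regions L diff_form (type_B n))) = ?c"
        using restr[OF mem] regions_drop_free_coordinate[of n L] Suc.prems 0 by simp
      then have "int (card (regions L diff_form (type_B (Suc n)))) = ?c + (2 * int n + 1) * ?c"
        by (simp only: rec)
      moreover have "?c = 2 ^ n * fact n" unfolding 0 by simp
      moreover have "K + (2 * int n + 1) * K = 2 * (int n + 1) * K" for K :: int
        by (simp add: distrib_right)
      moreover have "stirling_sum (Suc n) d = 0" unfolding 0 by simp
      ultimately show ?thesis unfolding factor by (simp only: mult_zero_right diff_zero)
    next
      case d: (Suc d')
      \<comment> \<open>Deletion keeps \<open>L\<close> and its dimension \<open>m\<close>;
        \<open>d\<close> and the number of coordinates both drop by one.\<close>
      have "int (card (regions L diff_form (type_B n))) = 2 ^ n * fact n - 2 * stirling_sum n d'"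
        using Suc.prems m d generic_forget[of n d' L] by (intro Suc.IH[of m]) auto
      then have "int (card (regions L diff_form (type_B (Suc n)))) =
          2 ^ n * fact n - 2 * stirling_sum n d' + (2 * int n + 1) * ?c"
        using rec by simp
      also have "\<dots> = 2 * (int n + 1) * (2 ^ n * fact n) - 2 * stirling_sum (Suc n) d"
        unfolding d stirling_sum_Suc_Suc by (simp add: algebra_simps)
      finally show ?thesis unfolding factor .
    qed
  qed
qed

end

section \<open>Chambers and signed permutations\<close>

text \<open>A decreasing chain of nonnegative numbers is exactly a sequence of tail sums of
  nonnegative weights, the shape that Abel summation produces.\<close>

definition in_closed_chamber :: "nat \<Rightarrow> signed_perm \<Rightarrow> (nat \<Rightarrow> real) \<Rightarrow> bool" where
  "in_closed_chamber n g v \<longleftrightarrow> (\<forall>i\<in>{1..n}. 0 \<le> snd g i * v (fst g i)) \<and>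
    (\<forall>i\<in>{1..n}. \<forall>j\<in>{1..n}. i < j \<longrightarrow> snd g j * v (fst g j) \<le> snd g i * v (fst g i))"

definition in_chamber :: "nat \<Rightarrow> signed_perm \<Rightarrow> (nat \<Rightarrow> real) \<Rightarrow> bool" where
  "in_chamber n g v \<longleftrightarrow> (\<forall>i\<in>{1..n}. 0 < snd g i * v (fst g i)) \<and>
    (\<forall>i\<in>{1..n}. \<forall>j\<in>{1..n}. i < j \<longrightarrow> snd g j * v (fst g j) < snd g i * v (fst g i))"

definition no_ties :: "nat \<Rightarrow> (nat \<Rightarrow> real) \<Rightarrow> bool" where
  "no_ties n v \<longleftrightarrow> (\<forall>i\<in>{1..n}. v i \<noteq> 0) \<and>
    (\<forall>i\<in>{1..n}. \<forall>j\<in>{1..n}. i \<noteq> j \<longrightarrow> \<bar>v i\<bar> \<noteq> \<bar>v j\<bar>)"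

definition same_order :: "nat \<Rightarrow> (nat \<Rightarrow> real) \<Rightarrow> (nat \<Rightarrow> real) \<Rightarrow> bool" where
  "same_order n v v' \<longleftrightarrow> (\<forall>i\<in>{1..n}. 0 < v i \<longleftrightarrow> 0 < v' i) \<and>
    (\<forall>i\<in>{1..n}. \<forall>j\<in>{1..n}. \<bar>v j\<bar> < \<bar>v i\<bar> \<longleftrightarrow> \<bar>v' j\<bar> < \<bar>v' i\<bar>)"

lemma signed_permsD:
  assumes "g \<in> signed_perms n"
  shows "fst g permutes {1..n}" "\<And>i. i \<in> {1..n} \<Longrightarrow> snd g i = 1 \<or> snd g i = -1"
    "snd g \<in> extensional {1..n}"
  using assms by (auto simp: signed_perms_def PiE_def)

lemma finite_signed_perms: "finite (signed_perms n)"
  unfolding signed_perms_def by (intro finite_cartesian_product finite_permutations finite_PiE) auto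

lemma in_closed_chamber_abs:
  assumes "g \<in> signed_perms n" "in_closed_chamber n g v" "i \<in> {1..n}"
  shows "\<bar>v (fst g i)\<bar> = snd g i * v (fst g i)"
  using signed_permsD(2)[OF assms(1,3)] assms(2,3) unfolding in_closed_chamber_def by fastforce

lemma in_chamber_imp_closed: "in_chamber n g v \<Longrightarrow> in_closed_chamber n g v"
  unfolding in_chamber_def in_closed_chamber_def by (simp add: less_imp_le)

text \<open>Sort the indices by decreasing absolute value and choose the signs that make all entries
  nonnegative.\<close>

lemma ex_closed_chamber:
  fixes v :: "nat \<Rightarrow> real"
  obtains g where "g \<in> signed_perms n" "in_closed_chamber n g v"
proof -
  \<comment> \<open>The negated key turns increasing sorting into decreasing order. List positions
    start at 0, hence \<open>i - 1\<close> in \<open>s\<close>.\<close>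
  define xs where "xs = sort_key (\<lambda>i. - \<bar>v i\<bar>) [1..<Suc n]"
  have xs: "length xs = n" "set xs = {1..n}" "distinct xs" "sorted (map (\<lambda>i. - \<bar>v i\<bar>) xs)"
    unfolding xs_def by auto
  define s where "s = (\<lambda>i. if i \<in> {1..n} then xs ! (i - 1) else i)"
  have "bij_betw ((!) xs \<circ> (\<lambda>i. i - 1)) {1..n} {1..n}"
  proof (rule bij_betw_trans)
    show "bij_betw (\<lambda>i. i - 1) {1..n} {..<n}"
      by (rule bij_betw_byWitness[of _ "\<lambda>i. i + 1"]) auto
    show "bij_betw ((!) xs) {..<n} {1..n}" using bij_betw_nth[OF xs(3)] xs(1,2) by auto
  qed
  then have "bij_betw s {1..n} {1..n}"
    by (rule iffD1[OF bij_betw_cong, rotated]) (simp add: s_def)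
  then have perm: "s permutes {1..n}" by (rule bij_imp_permutes) (auto simp: s_def)
  define g where "g = (s, \<lambda>i\<in>{1..n}. if v (s i) \<ge> 0 then 1 else -1 :: real)"
  have "g \<in> signed_perms n" using perm by (auto simp: g_def signed_perms_def)
  moreover have abs: "snd g i * v (fst g i) = \<bar>v (s i)\<bar>" if "i \<in> {1..n}" for i
    using that by (auto simp: g_def)
  moreover have "\<bar>v (s j)\<bar> \<le> \<bar>v (s i)\<bar>" if "i \<in> {1..n}" "j \<in> {1..n}" "i < j" for i j
  proof -
    have "map (\<lambda>i. - \<bar>v i\<bar>) xs ! (i - 1) \<le> map (\<lambda>i. - \<bar>v i\<bar>) xs ! (j - 1)"
      using that xs(1) by (intro sorted_nth_mono[OF xs(4)]) auto
    then show ?thesis using that xs(1) by (simp add: s_def)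
  qed
  ultimately show ?thesis using that by (simp add: in_closed_chamber_def)
qed

lemma in_chamber_if_no_ties:
  assumes "g \<in> signed_perms n" "in_closed_chamber n g v" "no_ties n v"
  shows "in_chamber n g v"
proof -
  have mem: "fst g i \<in> {1..n}" if "i \<in> {1..n}" for i
    using permutes_in_image[OF signed_permsD(1)[OF assms(1)]] that by blast
  have inj: "fst g i \<noteq> fst g j" if "i \<noteq> j" for i j
    using permutes_inj[OF signed_permsD(1)[OF assms(1)]] that by (auto dest: injD)
  have abs: "\<bar>v (fst g i)\<bar> = snd g i * v (fst g i)" if "i \<in> {1..n}" for i
    using in_closed_chamber_abs[OF assms(1,2) that] .
  have "snd g i * v (fst g i) \<noteq> 0" if "i \<in> {1..n}" for i
    using abs[OF that] assms(3) mem[OF that] unfolding no_ties_def by auto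
  moreover have "snd g j * v (fst g j) \<noteq> snd g i * v (fst g i)" if "i \<in> {1..n}" "j \<in> {1..n}" "i < j" for i j
    using abs that assms(3) mem inj[of i j] unfolding no_ties_def by (metis less_not_refl)
  ultimately show ?thesis
    using assms(2) unfolding in_chamber_def in_closed_chamber_def by (simp add: less_le)
qed

lemma in_chamber_abs_less_iff:
  assumes "g \<in> signed_perms n" "in_chamber n g v" "i \<in> {1..n}" "j \<in> {1..n}"
  shows "\<bar>v (fst g j)\<bar> < \<bar>v (fst g i)\<bar> \<longleftrightarrow> i < j"
proof -
  have "\<bar>v (fst g i)\<bar> = snd g i * v (fst g i)" "\<bar>v (fst g j)\<bar> = snd g j * v (fst g j)"
    using in_closed_chamber_abs[OF assms(1) in_chamber_imp_closed[OF assms(2)]] assms(3,4) by blast+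
  moreover have "i < j \<Longrightarrow> snd g j * v (fst g j) < snd g i * v (fst g i)"
    "j < i \<Longrightarrow> snd g i * v (fst g i) < snd g j * v (fst g j)"
    using assms(2-4) unfolding in_chamber_def by blast+
  ultimately show ?thesis by (cases i j rule: linorder_cases) auto
qed

lemma in_chamber_pos_iff:
  assumes "g \<in> signed_perms n" "in_chamber n g v" "i \<in> {1..n}"
  shows "0 < v (fst g i) \<longleftrightarrow> snd g i = 1"
proof -
  have "0 < snd g i * v (fst g i)" using assms(2,3) unfolding in_chamber_def by blast
  then show ?thesis using signed_permsD(2)[OF assms(1,3)] by auto
qed

lemma in_chamber_no_ties:
  assumes "g \<in> signed_perms n" "in_chamber n g v"
  shows "no_ties n v"
proof -
  have img: "fst g ` {1..n} = {1..n}" using permutes_image[OF signed_permsD(1)[OF assms(1)]] .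
  have "v i \<noteq> 0" if "i \<in> {1..n}" for i
  proof -
    obtain a where a: "a \<in> {1..n}" "i = fst g a" using img \<open>i \<in> {1..n}\<close> by blast
    then have "0 < snd g a * v (fst g a)" using assms(2) unfolding in_chamber_def by blast
    then show ?thesis using a(2) by auto
  qed
  moreover have "\<bar>v i\<bar> \<noteq> \<bar>v j\<bar>" if ij: "i \<in> {1..n}" "j \<in> {1..n}" "i \<noteq> j" for i j
  proof -
    obtain a where a: "a \<in> {1..n}" "i = fst g a" using img ij(1) by blast
    obtain b where b: "b \<in> {1..n}" "j = fst g b" using img ij(2) by blast
    have "a < b \<or> b < a" using ij(3) a(2) b(2) by (metis linorder_neqE_nat)
    then show ?thesis
      using in_chamber_abs_less_iff[OF assms a(1) b(1)] in_chamber_abs_less_iff[OF assms b(1) a(1)] a b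
      by auto
  qed
  ultimately show ?thesis unfolding no_ties_def by blast
qed

text \<open>Recovers the position of an entry from the order of the absolute values alone, so that
  this order determines the permutation.\<close>

lemma in_chamber_rank:
  assumes "g \<in> signed_perms n" "in_chamber n g v" "a \<in> {1..n}"
  shows "a = Suc (card {k \<in> {1..n}. \<bar>v (fst g a)\<bar> < \<bar>v k\<bar>})"
proof -
  have perm: "fst g permutes {1..n}" using signed_permsD(1)[OF assms(1)] .
  have "{k \<in> {1..n}. \<bar>v (fst g a)\<bar> < \<bar>v k\<bar>} = fst g ` {1..<a}"
  proof (intro equalityI subsetI)
    fix k assume k: "k \<in> {k \<in> {1..n}. \<bar>v (fst g a)\<bar> < \<bar>v k\<bar>}"
    then obtain b where "b \<in> {1..n}" "k = fst g b" using permutes_image[OF perm] by blast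
    then show "k \<in> fst g ` {1..<a}" using k in_chamber_abs_less_iff[OF assms(1,2)] assms(3) by auto
  next
    fix k assume "k \<in> fst g ` {1..<a}"
    then obtain b where b: "b \<in> {1..n}" "b < a" "k = fst g b" using assms(3) by auto
    then show "k \<in> {k \<in> {1..n}. \<bar>v (fst g a)\<bar> < \<bar>v k\<bar>}"
      using in_chamber_abs_less_iff[OF assms(1,2)] assms(3) permutes_in_image[OF perm] by auto
  qed
  moreover have "card (fst g ` {1..<a}) = a - 1"
    by (subst card_image) (auto intro: inj_on_subset[OF permutes_inj[OF perm]])
  ultimately show ?thesis using assms(3) by simp
qed

text \<open>Ranks give back the permutation and signs of entries give back the sign vector. With
  \<open>v = v'\<close> this says that a vector lies in at most one open chamber.\<close>

lemma chamber_eq_iff_same_order: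
  assumes "g \<in> signed_perms n" "in_chamber n g v" "g' \<in> signed_perms n" "in_chamber n g' v'"
  shows "g = g' \<longleftrightarrow> same_order n v v'"
proof
  assume "g = g'"
  have img: "fst g ` {1..n} = {1..n}" using permutes_image[OF signed_permsD(1)[OF assms(1)]] .
  have g': "in_chamber n g v'" using assms(4) \<open>g = g'\<close> by simp
  have "0 < v i \<longleftrightarrow> 0 < v' i" if i: "i \<in> {1..n}" for i
  proof -
    obtain a where "a \<in> {1..n}" "i = fst g a" using img i by blast
    then show ?thesis using in_chamber_pos_iff[OF assms(1,2)] in_chamber_pos_iff[OF assms(1) g'] by simp
  qed
  moreover have "\<bar>v j\<bar> < \<bar>v i\<bar> \<longleftrightarrow> \<bar>v' j\<bar> < \<bar>v' i\<bar>" if ij: "i \<in> {1..n}" "j \<in> {1..n}" for i j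
  proof -
    obtain a where "a \<in> {1..n}" "i = fst g a" using img ij(1) by blast
    moreover obtain b where "b \<in> {1..n}" "j = fst g b" using img ij(2) by blast
    ultimately show ?thesis
      using in_chamber_abs_less_iff[OF assms(1,2)] in_chamber_abs_less_iff[OF assms(1) g'] by simp
  qed
  ultimately show "same_order n v v'" unfolding same_order_def by blast
next
  assume same: "same_order n v v'"
  have perm: "fst g permutes {1..n}" "fst g' permutes {1..n}"
    using assms(1,3) by (auto dest: signed_permsD)
  have fst_eq: "fst g a = fst g' a" if a: "a \<in> {1..n}" for a
  proof -
    have mem: "fst g a \<in> {1..n}" using permutes_in_image[OF perm(1)] a by blast
    then obtain b where b: "b \<in> {1..n}" "fst g' b = fst g a" using permutes_image[OF perm(2)] by (metis imageE)
    have "{k \<in> {1..n}. \<bar>v (fst g a)\<bar> < \<bar>v k\<bar>} = {k \<in> {1..n}. \<bar>v' (fst g' b)\<bar> < \<bar>v' k\<bar>}"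
      using same mem unfolding same_order_def b(2) by blast
    then have "a = b"
      using in_chamber_rank[OF assms(1,2) a] in_chamber_rank[OF assms(3,4) b(1)] by simp
    then show ?thesis using b(2) by simp
  qed
  have "fst g = fst g'"
  proof
    fix a show "fst g a = fst g' a"
      using fst_eq[of a] permutes_not_in[OF perm(1), of a] permutes_not_in[OF perm(2), of a]
      by (cases "a \<in> {1..n}") auto
  qed
  moreover have "snd g = snd g'"
  \<comment> \<open>Agreement on \<open>{1..n}\<close> suffices because sign vectors are normalised
    outside it.\<close>
  proof (rule extensionalityI[of _ "{1..n}"])
    fix a assume a: "a \<in> {1..n}"
    then have "fst g a \<in> {1..n}" using permutes_in_image[OF perm(1)] by blast
    then have "snd g a = 1 \<longleftrightarrow> snd g' a = 1"
      using in_chamber_pos_iff[OF assms(1,2) a] in_chamber_pos_iff[OF assms(3,4) a] same fst_eq[OF a]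
      unfolding same_order_def by auto
    then show "snd g a = snd g' a"
      using signed_permsD(2)[OF assms(1) a] signed_permsD(2)[OF assms(3) a] by auto
  qed (use assms(1,3) in \<open>auto dest: signed_permsD\<close>)
  ultimately show "g = g'" by (rule prod_eqI)
qed

section \<open>Sign patterns of the arrangement as signed permutations\<close>

context signed_coordinates
begin

definition coords :: "'v \<Rightarrow> nat \<Rightarrow> real" where
  "coords y i = f (int i) y"

lemma diff_form_int:
  "diff_form (int k, int j) y = coords y k - coords y j" "diff_form (int k, - int j) y = coords y k + coords y j"
  by (auto simp: diff_form_def coords_def f_minus)

lemma type_B_E:
  assumes "h \<in> type_B n"
  obtains k where "k \<in> {1..n}" "h = (int k, 0)"
  | k j where "k \<in> {1..n}" "j \<in> {1..n}" "j < k" "h = (int k, int j)"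
  | k j where "k \<in> {1..n}" "j \<in> {1..n}" "j < k" "h = (int k, - int j)"
proof -
  obtain k j where h: "h = (k, j)" "1 \<le> k" "k \<le> int n" "\<bar>j\<bar> < k" using assms by (auto simp: type_B_def)
  have k: "h = (int (nat k), j)" "nat k \<in> {1..n}" using h by auto
  show ?thesis
  proof (cases j "0 :: int" rule: linorder_cases)
    case less
    then have "j = - int (nat (- j))" "nat (- j) \<in> {1..n}" "nat (- j) < nat k" using h by auto
    then show ?thesis using k that(3) by metis
  next
    case equal
    then show ?thesis using k that(1) by metis
  next
    case greater
    then have "j = int (nat j)" "nat j \<in> {1..n}" "nat j < nat k" using h by auto
    then show ?thesis using k that(2) by metis
  qed
qed

lemma off_type_B_iff_no_ties:
  "(\<forall>h\<in>type_B n. diff_form h y \<noteq> 0) \<longleftrightarrow> no_ties n (coords y)"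
proof
  assume L: "\<forall>h\<in>type_B n. diff_form h y \<noteq> 0"
  have less: "\<bar>coords y k\<bar> \<noteq> \<bar>coords y j\<bar>" if "k \<in> {1..n}" "j \<in> {1..n}" "j < k" for k j
  proof -
    have "(int k, int j) \<in> type_B n" "(int k, - int j) \<in> type_B n" using that by (auto simp: type_B_def)
    then have "coords y k - coords y j \<noteq> 0" "coords y k + coords y j \<noteq> 0"
      using L unfolding diff_form_int[symmetric] by blast+
    then show ?thesis by linarith
  qed
  have "coords y k \<noteq> 0" if "k \<in> {1..n}" for k
  proof -
    have "(int k, 0) \<in> type_B n" using that by (auto simp: type_B_def)
    then have "diff_form (int k, 0) y \<noteq> 0" using L by blast
    then show ?thesis by (simp add: diff_form_def coords_def)
  qed
  then show "no_ties n (coords y)"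
    using less unfolding no_ties_def by (metis linorder_neqE_nat)
next
  assume R: "no_ties n (coords y)"
  have nt: "\<bar>coords y k\<bar> \<noteq> \<bar>coords y j\<bar>" if "k \<in> {1..n}" "j \<in> {1..n}" "j < k" for k j
    using R that unfolding no_ties_def by (metis less_irrefl)
  show "\<forall>h\<in>type_B n. diff_form h y \<noteq> 0"
  proof
    fix h assume "h \<in> type_B n"
    then show "diff_form h y \<noteq> 0"
    proof (cases rule: type_B_E)
      case (1 k)
      then show ?thesis using R by (auto simp: no_ties_def diff_form_def coords_def)
    next
      case (2 k j)
      then show ?thesis using nt[OF 2(1-3)] diff_form_int(1)[of k j y] by auto
    next
      case (3 k j)
      then show ?thesis using nt[OF 3(1-3)] diff_form_int(2)[of k j y] by auto
    qed
  qed
qed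

text \<open>The sum and the difference of the entries at \<open>k\<close> and \<open>j\<close> both
  have the sign of the entry at \<open>k\<close> exactly when that entry is larger in absolute
  value. So the three kinds of forms encode signs and order, and nothing else.\<close>

lemma sign_pattern_eq_iff_same_order:
  assumes y: "no_ties n (coords y)" and z: "no_ties n (coords z)"
  shows "sign_pattern diff_form (type_B n) y = sign_pattern diff_form (type_B n) z \<longleftrightarrow>
    same_order n (coords y) (coords z)"
proof -
  have pat: "sign_pattern diff_form (type_B n) y = sign_pattern diff_form (type_B n) z \<longleftrightarrow>
      (\<forall>h\<in>type_B n. 0 < diff_form h y \<longleftrightarrow> 0 < diff_form h z)"
    by (auto simp: sign_pattern_def)
  have nt: "\<bar>coords y k\<bar> \<noteq> \<bar>coords y j\<bar>" "\<bar>coords z k\<bar> \<noteq> \<bar>coords z j\<bar>"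
    if "k \<in> {1..n}" "j \<in> {1..n}" "j < k" for k j
    using y z that unfolding no_ties_def by (metis less_irrefl)+
  show ?thesis unfolding pat
  proof
    assume L: "\<forall>h\<in>type_B n. 0 < diff_form h y \<longleftrightarrow> 0 < diff_form h z"
    have pos: "0 < coords y k \<longleftrightarrow> 0 < coords z k" if "k \<in> {1..n}" for k
    proof -
      have "(int k, 0) \<in> type_B n" using that by (auto simp: type_B_def)
      then have "0 < diff_form (int k, 0) y \<longleftrightarrow> 0 < diff_form (int k, 0) z" using L by blast
      then show ?thesis by (simp add: diff_form_def coords_def)
    qed
    have less_case: "(\<bar>coords y j\<bar> < \<bar>coords y k\<bar> \<longleftrightarrow> \<bar>coords z j\<bar> < \<bar>coords z k\<bar>)"
      if jk: "k \<in> {1..n}" "j \<in> {1..n}" "j < k" for k j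
    proof -
      have "(int k, int j) \<in> type_B n" "(int k, - int j) \<in> type_B n" using jk by (auto simp: type_B_def)
      then have "coords y k - coords y j > 0 \<longleftrightarrow> coords z k - coords z j > 0"
        "coords y k + coords y j > 0 \<longleftrightarrow> coords z k + coords z j > 0"
        using L unfolding diff_form_int[symmetric] by blast+
      then show ?thesis using nt[OF jk] pos[OF jk(1)] by linarith
    qed
    have "\<bar>coords y j\<bar> < \<bar>coords y k\<bar> \<longleftrightarrow> \<bar>coords z j\<bar> < \<bar>coords z k\<bar>"
      if jk: "k \<in> {1..n}" "j \<in> {1..n}" for k j
    proof (cases j k rule: linorder_cases)
      case less then show ?thesis using less_case[OF jk] by blast
    next
      case equal then show ?thesis by simp
    next
      case greater
      then show ?thesis using less_case[OF jk(2,1)] nt[OF jk(2,1)] by linarith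
    qed
    then show "same_order n (coords y) (coords z)" unfolding same_order_def using pos by blast
  next
    assume same: "same_order n (coords y) (coords z)"
    show "\<forall>h\<in>type_B n. 0 < diff_form h y \<longleftrightarrow> 0 < diff_form h z"
    proof
      fix h assume "h \<in> type_B n"
      then show "0 < diff_form h y \<longleftrightarrow> 0 < diff_form h z"
      proof (cases rule: type_B_E)
        case (1 k)
        then show ?thesis using same by (auto simp: same_order_def diff_form_def coords_def)
      next
        case (2 k j)
        have "(0 < coords y k \<longleftrightarrow> 0 < coords z k)" "(0 < coords y j \<longleftrightarrow> 0 < coords z j)"
          "\<bar>coords y j\<bar> < \<bar>coords y k\<bar> \<longleftrightarrow> \<bar>coords z j\<bar> < \<bar>coords z k\<bar>"
          using same 2(1,2) unfolding same_order_def by blast+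
        then show ?thesis unfolding 2(4) diff_form_int using nt[OF 2(1-3)] by linarith
      next
        case (3 k j)
        have "(0 < coords y k \<longleftrightarrow> 0 < coords z k)" "(0 < coords y j \<longleftrightarrow> 0 < coords z j)"
          "\<bar>coords y j\<bar> < \<bar>coords y k\<bar> \<longleftrightarrow> \<bar>coords z j\<bar> < \<bar>coords z k\<bar>"
          using same 3(1,2) unfolding same_order_def by blast+
        then show ?thesis unfolding 3(4) diff_form_int using nt[OF 3(1-3)] by linarith
      qed
    qed
  qed
qed

text \<open>The map \<open>G\<close> from a vector to its chamber and the sign pattern have the same
  fibres, both given by \<open>same_order\<close>.\<close>

lemma card_chambers_eq_card_regions:
  "card {g \<in> signed_perms n. \<exists>y\<in>L. in_chamber n g (coords y)} =
    card (regions L diff_form (type_B n))"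
proof -
  let ?S = "{y \<in> L. no_ties n (coords y)}"
  define G where "G y = (SOME g. g \<in> signed_perms n \<and> in_chamber n g (coords y))" for y
  have G: "G y \<in> signed_perms n" "in_chamber n (G y) (coords y)" if "y \<in> ?S" for y
  proof -
    obtain g where "g \<in> signed_perms n" "in_closed_chamber n g (coords y)" by (rule ex_closed_chamber)
    then have "\<exists>g. g \<in> signed_perms n \<and> in_chamber n g (coords y)"
      using in_chamber_if_no_ties that by blast
    from someI_ex[OF this] show "G y \<in> signed_perms n" "in_chamber n (G y) (coords y)"
      unfolding G_def by auto
  qed
  have G_eq: "G y = G z \<longleftrightarrow> same_order n (coords y) (coords z)" if "y \<in> ?S" "z \<in> ?S" for y z
    using G that by (intro chamber_eq_iff_same_order)
  have "{g \<in> signed_perms n. \<exists>y\<in>L. in_chamber n g (coords y)} = G ` ?S"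
  proof (intro equalityI subsetI)
    fix g assume "g \<in> {g \<in> signed_perms n. \<exists>y\<in>L. in_chamber n g (coords y)}"
    then obtain y where g: "g \<in> signed_perms n" "y \<in> L" "in_chamber n g (coords y)" by blast
    then have y: "y \<in> ?S" using in_chamber_no_ties by blast
    have "same_order n (coords y) (coords y)" by (simp add: same_order_def)
    then have "g = G y" using chamber_eq_iff_same_order[OF g(1,3) G[OF y]] by blast
    then show "g \<in> G ` ?S" using y by blast
  qed (use G in blast)
  also have "card (G ` ?S) = card (sign_pattern diff_form (type_B n) ` ?S)"
    using sign_pattern_eq_iff_same_order G_eq by (intro card_image_eq_card_image) auto
  finally show ?thesis unfolding regions_def off_type_B_iff_no_ties .
qed

end

section \<open>The kernel of a regular configuration\<close>

text \<open>Abel summation: the vector \<open>w i\<close> occurs in \<open>psum k w\<close>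
  precisely for \<open>i \<le> k\<close>, so it collects a tail of the coefficients.\<close>

lemma sum_psum:
  "(\<Sum>k = 1..n. l k *\<^sub>R psum k w) = (\<Sum>i = 1..n. (\<Sum>k = i..n. l k) *\<^sub>R w i)"
proof -
  have "(\<Sum>k = 1..n. l k *\<^sub>R psum k w) = (\<Sum>k = 1..n. \<Sum>i | i \<in> {1..n} \<and> i \<le> k. l k *\<^sub>R w i)"
    unfolding psum_def scaleR_right.sum by (intro sum.cong) auto
  also have "\<dots> = (\<Sum>i = 1..n. \<Sum>k | k \<in> {1..n} \<and> i \<le> k. l k *\<^sub>R w i)"
    by (rule sum.swap_restrict) auto
  also have "\<dots> = (\<Sum>i = 1..n. (\<Sum>k = i..n. l k) *\<^sub>R w i)"
    unfolding scaleR_left.sum by (intro sum.cong) auto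
  finally show ?thesis .
qed

lemma sum_act:
  assumes "g \<in> signed_perms n"
  shows "(\<Sum>i = 1..n. (snd g i * v (fst g i)) *\<^sub>R act g X i) = (\<Sum>j = 1..n. v j *\<^sub>R X j)"
proof -
  have "(\<Sum>i = 1..n. (snd g i * v (fst g i)) *\<^sub>R act g X i) = (\<Sum>i = 1..n. v (fst g i) *\<^sub>R X (fst g i))"
    using signed_permsD(2)[OF assms] by (intro sum.cong refl) (fastforce simp: act_def)
  also have "\<dots> = (\<Sum>j = 1..n. v j *\<^sub>R X j)"
    using sum.permute[OF signed_permsD(1)[OF assms], of "\<lambda>j. v j *\<^sub>R X j"] by (simp add: o_def)
  finally show ?thesis .
qed

text \<open>A telescoping sum. Cutting \<open>z\<close> off to 0 after \<open>n\<close> makes the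
  last difference \<open>z n\<close> itself.\<close>

lemma tail_sum_diff:
  fixes z :: "nat \<Rightarrow> real"
  assumes "i \<le> n"
  shows "(\<Sum>k = i..n. (if k \<le> n then z k else 0) - (if Suc k \<le> n then z (Suc k) else 0)) = z i"
proof -
  have "(\<Sum>k = i..n. h k - h (Suc k)) = h i - h (Suc n)" for h :: "nat \<Rightarrow> real"
    using assms by (induction n rule: dec_induct) auto
  from this[of "\<lambda>k. if k \<le> n then z k else 0"] show ?thesis using assms by simp
qed

section \<open>Relations between the partial sums\<close>

text \<open>Regularity speaks of index sets of size exactly \<open>d\<close>; a smaller support is
  padded to that size, which \<open>d \<le> n\<close> permits.\<close>

lemma regular_relation_trivial:
  fixes X :: "nat \<Rightarrow> real ^ 'd"
  assumes "regular_config n X" "CARD('d) \<le> n" "g \<in> signed_perms n"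
    and "(\<Sum>k = 1..n. l k *\<^sub>R psum k (act g X)) = 0"
    and "card {k \<in> {1..n}. l k \<noteq> 0} \<le> CARD('d)" and "k \<in> {1..n}"
  shows "l k = 0"
proof (rule ccontr)
  assume "l k \<noteq> 0"
  let ?J = "{k \<in> {1..n}. l k \<noteq> 0}"
  have "?J \<subseteq> {1..n}" "CARD('d) \<le> card {1..n}" using assms(2) by auto
  then obtain I where I: "?J \<subseteq> I" "I \<subseteq> {1..n}" "card I = CARD('d)"
    using exists_subset_between[OF assms(5)] by blast
  have "(\<Sum>k\<in>I. l k *\<^sub>R psum k (act g X)) = (\<Sum>k = 1..n. l k *\<^sub>R psum k (act g X))"
    using I(1,2) by (intro sum.mono_neutral_left) auto
  then have "family_dependent (\<lambda>i. psum i (act g X)) I"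
    unfolding family_dependent_def using assms(4,6) I(1) \<open>l k \<noteq> 0\<close> by (intro exI[of _ l]) auto
  then have "X \<in> degenerate_at g I" by (simp add: degenerate_at_def)
  then show False using assms(1,3) I(2,3) unfolding regular_config_def degenerate_def by blast
qed

text \<open>The support of \<open>l\<close> contains \<open>d\<close> indices \<open>I\<close> whose
  partial sums form a basis. Each missing partial sum can thus be given a small positive weight,
  compensated on \<open>I\<close>, where the weights are already positive.\<close>

lemma ex_positive_relation:
  fixes X :: "nat \<Rightarrow> real ^ 'd"
  assumes "regular_config n X" "CARD('d) \<le> n" "g \<in> signed_perms n"
    and "\<And>k. k \<in> {1..n} \<Longrightarrow> 0 \<le> l k" "(\<Sum>k = 1..n. l k) = 1"
    and "(\<Sum>k = 1..n. l k *\<^sub>R psum k (act g X)) = 0"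
  obtains m where "\<And>k. k \<in> {1..n} \<Longrightarrow> 0 < m k" "(\<Sum>k = 1..n. m k *\<^sub>R psum k (act g X)) = 0"
proof -
  let ?s = "\<lambda>k. psum k (act g X)"
  let ?J = "{k \<in> {1..n}. l k \<noteq> 0}" and ?K = "{k \<in> {1..n}. l k = 0}"
  have "\<exists>k\<in>{1..n}. l k \<noteq> 0" using assms(5) by (metis sum.neutral zero_neq_one)
  then have "\<not> card ?J \<le> CARD('d)"
    using regular_relation_trivial[OF assms(1-3,6)] by blast
  then have "CARD('d) \<le> card ?J" by linarith
  then obtain I where I: "I \<subseteq> ?J" "card I = CARD('d)"
    by (meson obtain_subset_with_card_n)
  have finI: "finite I" using I(1) by (rule finite_subset) simp
  have "\<not> family_dependent ?s I"
    using assms(1,3) I unfolding regular_config_def degenerate_def degenerate_at_def by blast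
  then have ind: "inj_on ?s I" "independent (?s ` I)"
    using family_dependent_iff[OF finI] by blast+
  have "UNIV \<subseteq> span (?s ` I)"
    using ind I(2) by (intro card_ge_dim_independent) (auto simp: card_image)
  then have "\<exists>c. ?s k = (\<Sum>i\<in>I. c i *\<^sub>R ?s i)" for k
  proof -
    have "?s k \<in> range (\<lambda>u. \<Sum>v\<in>?s ` I. u v *\<^sub>R v)"
      using \<open>UNIV \<subseteq> _\<close> span_finite[of "?s ` I"] finI by blast
    then obtain u where "?s k = (\<Sum>v\<in>?s ` I. u v *\<^sub>R v)" by blast
    then show ?thesis using ind(1) by (intro exI[of _ "\<lambda>i. u (?s i)"]) (simp add: sum.reindex)
  qed
  then obtain c where c: "\<And>k. ?s k = (\<Sum>i\<in>I. c k i *\<^sub>R ?s i)" by metis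
  \<comment> \<open>Coefficients of the relation stating that the sum of all \<open>?s k\<close>
    with \<open>k\<close> in \<open>?K\<close> equals its expansion in the basis indexed by
    \<open>I\<close>; it is 1 on \<open>?K\<close>, which is disjoint from \<open>I\<close>.\<close>
  define b where "b i = (if i \<in> ?K then 1 else 0) - (if i \<in> I then \<Sum>k\<in>?K. c k i else 0)" for i
  have sumI: "(\<Sum>i = 1..n. (if i \<in> I then h i else 0) *\<^sub>R ?s i) = (\<Sum>i\<in>I. h i *\<^sub>R ?s i)" for h
    using I(1) by (intro sum.mono_neutral_cong_right) auto
  have "(\<Sum>i = 1..n. b i *\<^sub>R ?s i) = (\<Sum>i = 1..n. (if i \<in> ?K then 1 else 0) *\<^sub>R ?s i) -
      (\<Sum>i = 1..n. (if i \<in> I then \<Sum>k\<in>?K. c k i else 0) *\<^sub>R ?s i)"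
    unfolding b_def scaleR_left_diff_distrib sum_subtractf ..
  also have "(\<Sum>i = 1..n. (if i \<in> ?K then 1 else 0) *\<^sub>R ?s i) = (\<Sum>k\<in>?K. ?s k)"
    by (intro sum.mono_neutral_cong_right) auto
  also have "\<dots> = (\<Sum>k\<in>?K. \<Sum>i\<in>I. c k i *\<^sub>R ?s i)" by (rule sum.cong[OF refl c])
  also have "\<dots> = (\<Sum>i\<in>I. (\<Sum>k\<in>?K. c k i) *\<^sub>R ?s i)"
    unfolding scaleR_left.sum by (rule sum.swap)
  finally have b0: "(\<Sum>i = 1..n. b i *\<^sub>R ?s i) = 0" unfolding sumI by simp
  obtain e where e: "e > 0" "\<And>t i. \<bar>t\<bar> \<le> e \<Longrightarrow> i \<in> ?J \<Longrightarrow> l i + t * b i \<noteq> 0 \<and> (l i + t * b i > 0 \<longleftrightarrow> l i > 0)"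
  proof (rule perturbation_keeps_signs[of ?J l b])
    show "finite ?J" "\<And>i. i \<in> ?J \<Longrightarrow> l i \<noteq> 0" by auto
  qed (rule that)
  show ?thesis
  proof (rule that[of "\<lambda>i. l i + e * b i"])
    fix k assume k: "k \<in> {1..n}"
    show "0 < l k + e * b k"
    proof (cases "l k = 0")
      case True
      then have "k \<notin> I" using I(1) by blast
      then show ?thesis using True k e(1) by (simp add: b_def)
    next
      case False
      then have "l k > 0" using assms(4)[OF k] by simp
      then show ?thesis using e(2)[of e k] e(1) False k by simp
    qed
  next
    have "(\<Sum>k = 1..n. (l k + e * b k) *\<^sub>R ?s k) =
        (\<Sum>k = 1..n. l k *\<^sub>R ?s k) + e *\<^sub>R (\<Sum>k = 1..n. b k *\<^sub>R ?s k)"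
      by (simp add: scaleR_add_left sum.distrib scaleR_right.sum)
    then show "(\<Sum>k = 1..n. (l k + e * b k) *\<^sub>R ?s k) = 0" using assms(6) b0 by simp
  qed
qed

text \<open>Points with different indices may coincide, so the weight of each point is given to one
  representative index in \<open>C\<close>.\<close>

lemma convex_hull_finite_image:
  assumes "finite A" "x \<in> convex hull (s ` A)"
  obtains l :: "'a \<Rightarrow> real" where "\<And>k. k \<in> A \<Longrightarrow> 0 \<le> l k" "sum l A = 1" "(\<Sum>k\<in>A. l k *\<^sub>R s k) = x"
proof -
  obtain u where u: "\<forall>p\<in>s ` A. 0 \<le> u p" "sum u (s ` A) = 1" "(\<Sum>p\<in>s ` A. u p *\<^sub>R p) = x"
    using assms by (auto simp: convex_hull_finite)
  obtain C where C: "C \<subseteq> A" "inj_on s C" "s ` A = s ` C" using subset_image_inj[of "s ` A" s A] by blast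
  have "(\<Sum>k\<in>A. if k \<in> C then u (s k) else 0) = (\<Sum>k\<in>C. u (s k))"
    using assms(1) C(1) by (intro sum.mono_neutral_cong_right) auto
  also have "\<dots> = 1" using u(2) C(2,3) by (simp add: sum.reindex)
  finally have 1: "(\<Sum>k\<in>A. if k \<in> C then u (s k) else 0) = 1" .
  have "(\<Sum>k\<in>A. (if k \<in> C then u (s k) else 0) *\<^sub>R s k) = (\<Sum>k\<in>C. u (s k) *\<^sub>R s k)"
    using assms(1) C(1) by (intro sum.mono_neutral_cong_right) auto
  also have "\<dots> = x" using u(3) C(2,3) by (simp add: sum.reindex)
  finally show ?thesis using that[OF _ 1] u(1) by auto
qed

text \<open>Bounded sequences serve as one vector space containing \<open>\<real>\<^sup>n\<close> for every \<open>n\<close>.\<close>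

definition truncated :: "nat \<Rightarrow> (nat \<Rightarrow> real) \<Rightarrow> nat \<Rightarrow>\<^sub>C real" where
  "truncated n v = Bcontfun (\<lambda>i. if i \<in> {1..n} then v i else 0)"

lemma apply_truncated [simp]: "apply_bcontfun (truncated n v) i = (if i \<in> {1..n} then v i else 0)"
proof -
  have "(\<lambda>i. if i \<in> {1..n} then v i else 0) \<in> bcontfun"
  proof (rule bcontfun_normI)
    show "continuous_on UNIV (\<lambda>i. if i \<in> {1..n} then v i else 0)" by simp
    show "norm (if i \<in> {1..n} then v i else 0) \<le> (\<Sum>j = 1..n. \<bar>v j\<bar>)" for i
      by (auto intro: member_le_sum sum_nonneg)
  qed
  then show ?thesis unfolding truncated_def by (simp add: Bcontfun_inverse)
qed

lemma linear_apply_bcontfun: "linear (\<lambda>y :: nat \<Rightarrow>\<^sub>C real. apply_bcontfun y i)"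
  by (rule linearI) auto

definition supported :: "nat \<Rightarrow> (nat \<Rightarrow>\<^sub>C real) set" where
  "supported n = {y. \<forall>i. i \<notin> {1..n} \<longrightarrow> apply_bcontfun y i = 0}"

lemma has_dim_supported: "has_dim n (supported n)"
proof -
  define e where "e j = truncated n (\<lambda>i. if i = j then 1 else 0)" for j
  have e: "apply_bcontfun (e j) i = (if i = j then 1 else 0)" if "j \<in> {1..n}" for i j
    using that by (auto simp: e_def)
  have inj: "inj_on e {1..n}"
    by (rule inj_onI) (metis e zero_neq_one)
  have comb: "apply_bcontfun (\<Sum>j = 1..n. u j *\<^sub>R e j) i = (if i \<in> {1..n} then u i else 0)" for u i
  proof -
    have "apply_bcontfun (\<Sum>j = 1..n. u j *\<^sub>R e j) i = (\<Sum>j = 1..n. u j * apply_bcontfun (e j) i)"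
      by (simp add: linear_sum[OF linear_apply_bcontfun])
    also have "\<dots> = (\<Sum>j = 1..n. if j = i then u j else 0)" by (intro sum.cong) (auto simp: e)
    finally show ?thesis by simp
  qed
  have "independent (e ` {1..n})"
  proof (subst dependent_finite)
    show "\<not> (\<exists>u. (\<exists>v\<in>e ` {1..n}. u v \<noteq> 0) \<and> (\<Sum>v\<in>e ` {1..n}. u v *\<^sub>R v) = 0)"
    proof clarify
      fix u i assume i: "i \<in> {1..n}" "u (e i) \<noteq> 0" and "(\<Sum>v\<in>e ` {1..n}. u v *\<^sub>R v) = 0"
      then have "(\<Sum>j = 1..n. u (e j) *\<^sub>R e j) = 0" by (simp only: sum.reindex[OF inj] o_def)
      then show False using comb[of "\<lambda>j. u (e j)" i] i by simp
    qed
  qed simp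
  moreover have "span (e ` {1..n}) = supported n"
  proof
    have "subspace (supported n)" by (auto simp: subspace_def supported_def)
    then show "span (e ` {1..n}) \<subseteq> supported n"
      by (intro span_minimal) (auto simp: supported_def e)
    show "supported n \<subseteq> span (e ` {1..n})"
    proof
      fix y assume "y \<in> supported n"
      then have "y = (\<Sum>j = 1..n. apply_bcontfun y j *\<^sub>R e j)"
        by (intro bcontfun_eqI, unfold comb) (auto simp: supported_def)
      also have "\<dots> \<in> span (e ` {1..n})" by (intro span_sum span_scale span_base) auto
      finally show "y \<in> span (e ` {1..n})" .
    qed
  qed
  moreover have "card (e ` {1..n}) = n" unfolding card_image[OF inj] by simp
  ultimately show ?thesis
    unfolding has_dim_def by (intro exI[of _ "e ` {1..n}"]) simp
qed

text \<open>The factor \<open>sgn j\<close> makes the extension odd in \<open>j\<close> and zero at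
  0, whatever entry the sequence has there.\<close>

definition coordinate :: "int \<Rightarrow> (nat \<Rightarrow>\<^sub>C real) \<Rightarrow> real" where
  "coordinate j y = of_int (sgn j) * apply_bcontfun y (nat \<bar>j\<bar>)"

interpretation coordinate: signed_coordinates coordinate
proof (rule signed_coordinates.intro)
  show "linear (coordinate j)" for j
    by (rule linearI) (auto simp: coordinate_def algebra_simps)
  show "coordinate (- j) y = - coordinate j y" for j y
    by (simp add: coordinate_def sgn_minus)
qed

lemma coords_coordinate: "i \<in> {1..n} \<Longrightarrow> coordinate.coords y i = apply_bcontfun y i"
  by (simp add: coordinate.coords_def coordinate_def)

section \<open>Kernel vectors as relations between partial sums\<close>

text \<open>Requiring support in \<open>{1..n}\<close> lets the coordinates determine
  \<open>y\<close>, so that a vector with all of them zero is zero.\<close>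

definition kernel :: "nat \<Rightarrow> (nat \<Rightarrow> real ^ 'd) \<Rightarrow> (nat \<Rightarrow>\<^sub>C real) set" where
  "kernel n X = {y \<in> supported n. (\<Sum>i = 1..n. apply_bcontfun y i *\<^sub>R X i) = 0}"

lemma kernel_relation:
  assumes "y \<in> kernel n X" "g \<in> signed_perms n"
    and l: "\<And>i. i \<in> {1..n} \<Longrightarrow> (\<Sum>k = i..n. l k) = snd g i * coordinate.coords y (fst g i)"
  shows "(\<Sum>k = 1..n. l k *\<^sub>R psum k (act g X)) = 0"
proof -
  have "(\<Sum>k = 1..n. l k *\<^sub>R psum k (act g X)) =
      (\<Sum>i = 1..n. (snd g i * coordinate.coords y (fst g i)) *\<^sub>R act g X i)"
    unfolding sum_psum by (intro sum.cong) (auto simp: l)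
  also have "\<dots> = (\<Sum>j = 1..n. coordinate.coords y j *\<^sub>R X j)" by (rule sum_act[OF assms(2)])
  also have "\<dots> = (\<Sum>j = 1..n. apply_bcontfun y j *\<^sub>R X j)"
    by (intro sum.cong) (auto simp: coords_coordinate)
  finally show ?thesis using assms(1) by (simp add: kernel_def)
qed

text \<open>Converse of \<open>kernel_relation\<close>: the tail sums of any relation are the
  signed, permuted coordinates of a kernel vector.\<close>

lemma ex_kernel_of_relation:
  assumes g: "g \<in> signed_perms n" and "(\<Sum>k = 1..n. l k *\<^sub>R psum k (act g X)) = 0"
  obtains y where "y \<in> kernel n X"
    "\<And>i. i \<in> {1..n} \<Longrightarrow> snd g i * coordinate.coords y (fst g i) = (\<Sum>k = i..n. l k)"
proof -
  have perm: "fst g permutes {1..n}" using signed_permsD(1)[OF g] .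
  \<comment> \<open>Solves the required equation for the coordinates, a sign being its own
    inverse.\<close>
  define v where "v j = snd g (inv (fst g) j) * (\<Sum>k = inv (fst g) j..n. l k)" for j
  define y where "y = truncated n v"
  have vg: "snd g i * v (fst g i) = (\<Sum>k = i..n. l k)" if "i \<in> {1..n}" for i
    using signed_permsD(2)[OF g that] by (auto simp: v_def permutes_inverses[OF perm])
  have yv: "apply_bcontfun y j = v j" if "j \<in> {1..n}" for j using that by (simp add: y_def)
  have "(\<Sum>i = 1..n. apply_bcontfun y i *\<^sub>R X i) = (\<Sum>j = 1..n. v j *\<^sub>R X j)"
    by (intro sum.cong) (auto simp: yv)
  also have "\<dots> = (\<Sum>i = 1..n. (snd g i * v (fst g i)) *\<^sub>R act g X i)" by (rule sum_act[OF g, symmetric])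
  also have "\<dots> = (\<Sum>k = 1..n. l k *\<^sub>R psum k (act g X))"
    unfolding sum_psum by (intro sum.cong) (auto simp: vg)
  finally have "y \<in> kernel n X" using assms(2) by (auto simp: kernel_def supported_def y_def)
  moreover have "snd g i * coordinate.coords y (fst g i) = (\<Sum>k = i..n. l k)" if "i \<in> {1..n}" for i
  proof -
    have "fst g i \<in> {1..n}" using permutes_in_image[OF perm] that by blast
    then show ?thesis using coords_coordinate[of _ n y] yv vg[OF that] by simp
  qed
  ultimately show ?thesis by (rule that)
qed

text \<open>The coefficients of the relation attached to \<open>y\<close> are the drops in its
  decreasing sequence of absolute values. There are no more nonzero drops than distinct nonzero
  values, so few values force the trivial relation.\<close>

lemma generic_kernel:
  fixes X :: "nat \<Rightarrow> real ^ 'd"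
  assumes "regular_config n X" "CARD('d) \<le> n"
  shows "coordinate.generic n CARD('d) (kernel n X)"
  unfolding coordinate.generic_def
proof (intro ballI impI, rule ccontr)
  fix y assume y: "y \<in> kernel n X" "y \<noteq> 0" and few: "\<not> CARD('d) < card (coordinate.abs_values n y)"
  let ?v = "coordinate.coords y"
  obtain g where g: "g \<in> signed_perms n" "in_closed_chamber n g ?v" by (rule ex_closed_chamber)
  have perm: "fst g permutes {1..n}" using signed_permsD(1)[OF g(1)] .
  define z where "z k = (if k \<le> n then snd g k * ?v (fst g k) else 0)" for k
  define l where "l k = z k - z (Suc k)" for k
  have z0: "0 \<le> z k" if "1 \<le> k" for k using g(2) that by (auto simp: z_def in_closed_chamber_def)
  have mono: "z j \<le> z i" if "1 \<le> i" "i \<le> j" for i j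
  proof (cases "i < j \<and> j \<le> n")
    case True
    then show ?thesis using g(2) that by (auto simp: z_def in_closed_chamber_def)
  next
    case False
    then show ?thesis using that z0[of i] by (auto simp: z_def le_less)
  qed
  have tail: "(\<Sum>k = i..n. l k) = snd g i * ?v (fst g i)" if "i \<in> {1..n}" for i
    using tail_sum_diff[of i n "\<lambda>k. snd g k * ?v (fst g k)"] that unfolding l_def z_def by simp
  have rel: "(\<Sum>k = 1..n. l k *\<^sub>R psum k (act g X)) = 0"
    by (rule kernel_relation[OF y(1) g(1) tail])
  let ?J = "{k \<in> {1..n}. l k \<noteq> 0}"
  \<comment> \<open>A nonzero \<open>l k\<close> is a strict drop after \<open>k\<close>: this makes
    the values \<open>z k\<close> over \<open>?J\<close> distinct and, the next one being at least
    0, positive.\<close>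
  have drop: "z (Suc k) < z k" if "k \<in> ?J" for k
    using that mono[of k "Suc k"] by (auto simp: l_def)
  have "inj_on z ?J"
  proof (rule linorder_inj_onI)
    fix i j assume "i < j" "i \<in> ?J" "j \<in> ?J"
    then have "z j \<le> z (Suc i)" by (intro mono) auto
    then show "z i \<noteq> z j" using drop[OF \<open>i \<in> ?J\<close>] by simp
  qed auto
  moreover have "z ` ?J \<subseteq> coordinate.abs_values n y"
  proof
    fix x assume "x \<in> z ` ?J"
    then obtain k where k: "k \<in> ?J" "x = z k" by blast
    then have "x > 0" using drop[OF k(1)] z0[of "Suc k"] by simp
    have mem: "fst g k \<in> {1..n}" using permutes_in_image[OF perm] k(1) by blast
    have "x = \<bar>?v (fst g k)\<bar>"
      using in_closed_chamber_abs[OF g, of k] k by (simp add: z_def)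
    then have "x = \<bar>coordinate (int (fst g k)) y\<bar>" by (simp add: coordinate.coords_def)
    then show "x \<in> coordinate.abs_values n y"
      using mem \<open>x > 0\<close> unfolding coordinate.abs_values_def by auto
  qed
  ultimately have "card ?J \<le> card (coordinate.abs_values n y)"
    by (rule card_inj_on_le[OF _ _ coordinate.finite_abs_values])
  then have l0: "l k = 0" if "k \<in> {1..n}" for k
    using regular_relation_trivial[OF assms g(1) rel _ that] few by simp
  have "apply_bcontfun y j = 0" for j
  proof (cases "j \<in> {1..n}")
    case True
    then obtain i where i: "i \<in> {1..n}" "j = fst g i" using permutes_image[OF perm] by blast
    have "snd g i * ?v j = 0" using tail[OF i(1)] l0 i by simp
    then have "?v j = 0" using signed_permsD(2)[OF g(1) i(1)] by auto
    then show ?thesis using coords_coordinate[OF True] by simp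
  next
    case False
    then show ?thesis using y(1) by (simp add: kernel_def supported_def)
  qed
  then have "y = 0" by (intro bcontfun_eqI) simp
  then show False using y(2) by simp
qed

text \<open>The \<open>d\<close> coordinate equations bound the dimension from below, genericity
  bounds it from above.\<close>

lemma has_dim_kernel_regular:
  fixes X :: "nat \<Rightarrow> real ^ 'd"
  assumes "regular_config n X" "CARD('d) \<le> n"
  obtains m where "has_dim m (kernel n X)" "m + CARD('d) = n"
proof -
  let ?r = "\<lambda>(c :: 'd) y :: nat \<Rightarrow>\<^sub>C real. (\<Sum>i = 1..n. apply_bcontfun y i *\<^sub>R X i) $ c"
  have "linear (?r c)" for c
    by (rule linearI) (auto simp: algebra_simps sum.distrib sum_distrib_left)
  then obtain m where m: "n \<le> m + card (UNIV :: 'd set)"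
      "has_dim m {y \<in> supported n. \<forall>c\<in>UNIV. ?r c y = 0}"
    using has_dim_kernels[OF _ has_dim_supported, of UNIV ?r n] by auto
  have "{y \<in> supported n. \<forall>c\<in>UNIV. ?r c y = 0} = kernel n X"
    by (auto simp: kernel_def vec_eq_iff)
  then have "has_dim m (kernel n X)" using m(2) by simp
  moreover from this have "m + CARD('d) \<le> n"
    using coordinate.generic_dim_le generic_kernel[OF assms] assms(2) by blast
  ultimately show ?thesis using that m(1) by force
qed

section \<open>From convex hulls to chambers, and the count\<close>

text \<open>Positive weights have positive, strictly decreasing tail sums, which is the open
  chamber. Conversely the successive drops of a chamber vector are nonnegative weights, to be
  normalised to total 1.\<close>

lemma zero_in_walk_hull_iff:
  fixes X :: "nat \<Rightarrow> real ^ 'd"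
  assumes "regular_config n X" "CARD('d) \<le> n" "g \<in> signed_perms n"
  shows "0 \<in> walk_hull n (act g X) \<longleftrightarrow> (\<exists>y\<in>kernel n X. in_chamber n g (coordinate.coords y))"
proof
  assume "0 \<in> walk_hull n (act g X)"
  then obtain l where l: "\<And>k. k \<in> {1..n} \<Longrightarrow> 0 \<le> l k" "(\<Sum>k = 1..n. l k) = 1"
      "(\<Sum>k = 1..n. l k *\<^sub>R psum k (act g X)) = 0"
    using convex_hull_finite_image[of "{1..n}" 0 "\<lambda>k. psum k (act g X)"] unfolding walk_hull_def by auto
  obtain m where m: "\<And>k. k \<in> {1..n} \<Longrightarrow> 0 < m k" "(\<Sum>k = 1..n. m k *\<^sub>R psum k (act g X)) = 0"
    using ex_positive_relation[OF assms l] by blast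
  obtain y where y: "y \<in> kernel n X"
      "\<And>i. i \<in> {1..n} \<Longrightarrow> snd g i * coordinate.coords y (fst g i) = (\<Sum>k = i..n. m k)"
    using ex_kernel_of_relation[OF assms(3) m(2)] by blast
  have "0 < (\<Sum>k = i..n. m k)" if "i \<in> {1..n}" for i
    using that m(1) by (intro sum_pos) auto
  moreover have "(\<Sum>k = j..n. m k) < (\<Sum>k = i..n. m k)" if "i \<in> {1..n}" "j \<in> {1..n}" "i < j" for i j
    using that m(1) by (intro sum_strict_mono2[of _ _ i]) (auto intro: less_imp_le)
  ultimately show "\<exists>y\<in>kernel n X. in_chamber n g (coordinate.coords y)"
    using y by (intro bexI[OF _ y(1)]) (simp add: in_chamber_def)
next
  assume "\<exists>y\<in>kernel n X. in_chamber n g (coordinate.coords y)"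
  then obtain y where y: "y \<in> kernel n X" "in_chamber n g (coordinate.coords y)" by blast
  define z where "z k = (if k \<le> n then snd g k * coordinate.coords y (fst g k) else 0)" for k
  define l where "l k = z k - z (Suc k)" for k
  have n: "1 \<in> {1..n}" using assms(2) by (simp add: Suc_le_eq order.strict_trans2[OF zero_less_card_finite])
  have tail: "(\<Sum>k = i..n. l k) = snd g i * coordinate.coords y (fst g i)" if "i \<in> {1..n}" for i
    using tail_sum_diff[of i n "\<lambda>k. snd g k * coordinate.coords y (fst g k)"] that
    unfolding l_def z_def by simp
  have rel: "(\<Sum>k = 1..n. l k *\<^sub>R psum k (act g X)) = 0"
    by (rule kernel_relation[OF y(1) assms(3) tail])
  have l0: "0 \<le> l k" if "k \<in> {1..n}" for k
    using y(2) that by (cases "Suc k \<le> n") (auto simp: l_def z_def in_chamber_def intro: less_imp_le)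
  \<comment> \<open>This is the tail sum from 1, the first coordinate in the order of
    \<open>g\<close>, which the open chamber makes positive.\<close>
  define S where "S = (\<Sum>k = 1..n. l k)"
  have "S > 0" using tail[OF n] y(2) n unfolding in_chamber_def S_def by simp
  have "(\<Sum>k = 1..n. l k / S) = 1"
    unfolding sum_divide_distrib[symmetric] S_def[symmetric] using \<open>S > 0\<close> by simp
  then have "(\<Sum>k\<in>{1..n}. (l k / S) *\<^sub>R psum k (act g X)) \<in> walk_hull n (act g X)"
    unfolding walk_hull_def using l0 \<open>S > 0\<close>
    by (intro convex_sum) (auto intro: hull_inc)
  also have "(\<Sum>k\<in>{1..n}. (l k / S) *\<^sub>R psum k (act g X)) = (1 / S) *\<^sub>R (\<Sum>k = 1..n. l k *\<^sub>R psum k (act g X))"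
    by (simp add: scaleR_right.sum)
  finally show "0 \<in> walk_hull n (act g X)" using rel by simp
qed

lemma card_missing:
  fixes X :: "nat \<Rightarrow> real ^ 'd"
  assumes "regular_config n X" "CARD('d) \<le> n"
  shows "int (card (missing n X)) = 2 * stirling_sum n CARD('d)"
proof -
  let ?C = "{g \<in> signed_perms n. \<exists>y\<in>kernel n X. in_chamber n g (coordinate.coords y)}"
  obtain m where "has_dim m (kernel n X)" "m + CARD('d) = n" using has_dim_kernel_regular[OF assms] .
  then have C: "int (card ?C) = 2 ^ n * fact n - 2 * stirling_sum n CARD('d)"
    using coordinate.card_regions_type_B generic_kernel[OF assms]
    by (simp add: coordinate.card_chambers_eq_card_regions)
  have "missing n X = signed_perms n - ?C"
    using zero_in_walk_hull_iff[OF assms] by (auto simp: missing_def)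
  then have "card (missing n X) = card (signed_perms n) - card ?C"
    by (simp add: card_Diff_subset finite_signed_perms)
  moreover have "card ?C \<le> card (signed_perms n)" by (rule card_mono[OF finite_signed_perms]) auto
  ultimately show ?thesis using C by (simp add: card_signed_perms of_nat_diff)
qed

theorem theorem9:
  fixes n :: nat
  assumes "n \<ge> CARD('d) + 1"
  shows "(\<forall>X :: nat \<Rightarrow> real ^ 'd. regular_config n X \<longrightarrow>
            int (card (missing n X)) =
              2 * (\<Sum>q. B_stirling n (int CARD('d) - 1 - 2 * int q))) \<and>
         (\<forall>(X :: nat \<Rightarrow> real ^ 'd) (Y :: nat \<Rightarrow> real ^ 'd).
            regular_config n X \<longrightarrow> regular_config n Y \<longrightarrow>
            card (missing n X) = card (missing n Y))"
proof -
  have "int (card (missing n X)) = 2 * (\<Sum>q. B_stirling n (int CARD('d) - 1 - 2 * int q))"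
    if "regular_config n X" for X :: "nat \<Rightarrow> real ^ 'd"
    using card_missing[OF that] assms unfolding stirling_sum_def by simp
  then show ?thesis by (metis of_nat_eq_iff)
qed

end
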